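(* Let $\Delta \ge 3$ be an integer and let $\lambda_c(\Delta) = \frac{(\Delta-1)^{\Delta-1}}{(\Delta-2)^{\Delta}}$. For any $n$-vertex graph $G=(V,E)$ of maximum degree $\Delta$, the Glauber dynamics for the hardcore model on $G$ with fugacity $\lambda = \lambda_c(\Delta)$ has mixing time $$T_{\mathrm{mix}}(P_{\mathrm{GD}}) = O\left( n^{4+\frac{4}{\Delta-2}} \log \Delta\right),$$ where the implied constant does not depend on $n$ or $G$.
   Context: For a graph $G=(V,E)$, let $\mathcal{I}(G)$ be the set of independent sets of $G$. The hardcore model on $G$ with fugacity $\lambda>0$ is the Gibbs distribution $\mu_{G,\lambda}(\sigma) = \lambda^{|\sigma|}/Z_{G,\lambda}$ for $\sigma\in\mathcal{I}(G)$, where $Z_{G,\lambda}=\sum_{\sigma\in\mathcal{I}(G)}\lambda^{|\sigma|}$. The Glauber dynamics $P_{\mathrm{GD}}$ is the Markov chain on $\mathcal{I}(G)$ which, from the current set $\sigma_t$, picks $v\in V$ uniformly at random, sets $S=\sigma_t\setminus\{v\}$; if $S\cup\{v\}\notin\mathcal{I}(G)$ then $\sigma_{t+1}=S$; otherwise $\sigma_{t+1}=S\cup\{v\}$ with probability $\lambda/(1+\lambda)$ and $\sigma_{t+1}=S$ with probability $1/(1+\lambda)$. Its mixing time is $T_{\mathrm{mix}}(P_{\mathrm{GD}}) = \max_{\sigma_0\in\mathcal{I}(G)}\min\{t\in\mathbb{N} : d_{\mathrm{TV}}(P_{\mathrm{GD}}^t(\sigma_0,\cdot),\mu_{G,\lambda})\le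 1/4\}$, where $d_{\mathrm{TV}}$ is total variation distance. *)

theory Defs
  imports "HOL-Probability.Probability"
begin

definition simple_graph :: "'a set \<Rightarrow> 'a set set \<Rightarrow> bool" where
  "simple_graph V E \<longleftrightarrow> finite V \<and> (\<forall>e\<in>E. e \<subseteq> V \<and> card e = 2)"

definition vertex_degree :: "'a set set \<Rightarrow> 'a \<Rightarrow> nat" where
  "vertex_degree E v = card {e \<in> E. v \<in> e}"

text \<open>The inserted 0 only fixes the value for the graph without vertices.\<close>

definition max_degree :: "'a set \<Rightarrow> 'a set set \<Rightarrow> nat" where
  "max_degree V E = Max (insert 0 (vertex_degree E ` V))"

definition independent_sets :: "'a set \<Rightarrow> 'a set set \<Rightarrow> 'a set set" where
  "independent_sets V E = {S. S \<subseteq> V \<and> (\<forall>u\<in>S. \<forall>v\<in>S. {u, v} \<notin> E)}"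

definition partition_fun :: "'a set \<Rightarrow> 'a set set \<Rightarrow> real \<Rightarrow> real" where
  "partition_fun V E lam = (\<Sum>\<sigma>\<in>independent_sets V E. lam ^ card \<sigma>)"

definition hardcore :: "'a set \<Rightarrow> 'a set set \<Rightarrow> real \<Rightarrow> 'a set \<Rightarrow> real" where
  "hardcore V E lam \<sigma> =
     (if \<sigma> \<in> independent_sets V E then lam ^ card \<sigma> / partition_fun V E lam else 0)"

text \<open>Meaningful only for nonempty \<open>V\<close>, where \<^term>\<open>pmf_of_set V\<close> is the uniform choice of a vertex.\<close>

definition glauber_step :: "'a set \<Rightarrow> 'a set set \<Rightarrow> real \<Rightarrow> 'a set \<Rightarrow> 'a set pmf" where
  "glauber_step V E lam \<sigma> =
     bind_pmf (pmf_of_set V) (\<lambda>v.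
       let S = \<sigma> - {v} in
       if S \<union> {v} \<notin> independent_sets V E then return_pmf S
       else map_pmf (\<lambda>b. if b then S \<union> {v} else S) (bernoulli_pmf (lam / (1 + lam))))"

primrec iterate_kernel :: "('s \<Rightarrow> 's pmf) \<Rightarrow> nat \<Rightarrow> 's \<Rightarrow> 's pmf" where
  "iterate_kernel P 0 x = return_pmf x"
| "iterate_kernel P (Suc t) x = bind_pmf (iterate_kernel P t x) P"

definition tv_dist :: "'s set \<Rightarrow> ('s \<Rightarrow> real) \<Rightarrow> ('s \<Rightarrow> real) \<Rightarrow> real" where
  "tv_dist \<Omega> p q = (1 / 2) * (\<Sum>x\<in>\<Omega>. \<bar>p x - q x\<bar>)"

text \<open>The value is an extended natural number, so that the minimum over an empty set
  of times is infinite: a finite bound on the mixing time includes the claim that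
  the chain gets within distance 1/4 from every starting state.\<close>

definition mixing_time :: "'s set \<Rightarrow> ('s \<Rightarrow> 's pmf) \<Rightarrow> ('s \<Rightarrow> real) \<Rightarrow> enat" where
  "mixing_time \<Omega> P \<mu> =
     (MAX x\<in>\<Omega>. INF t\<in>{t. tv_dist \<Omega> (pmf (iterate_kernel P t x)) \<mu> \<le> 1 / 4}. enat t)"

definition glauber_mixing_time :: "'a set \<Rightarrow> 'a set set \<Rightarrow> real \<Rightarrow> enat" where
  "glauber_mixing_time V E lam =
     mixing_time (independent_sets V E) (glauber_step V E lam) (hardcore V E lam)"

definition lambda_c :: "nat \<Rightarrow> real" where
  "lambda_c \<Delta> = (real \<Delta> - 1) ^ (\<Delta> - 1) / (real \<Delta> - 2) ^ \<Delta>"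

end

theory Submission
  imports Defs
begin

text \<open>Write \<open>d = \<Delta> - 1\<close> and parametrise the fugacity as \<open>t = a / (1 - a) ^ (d + 1)\<close>, so that
  \<open>a\<close> is the cavity marginal of the \<open>d\<close>-ary tree and \<open>a = 1 / d\<close> is the critical point.
  Deleting a vertex with at most \<open>d\<close> neighbours and marginal \<open>p\<close> changes all marginals by at most
  \<open>min p a / (1 - d a)\<close> in total. This bound reproduces itself when the neighbours of a vertex are
  deleted one at a time, and shows that the total influence of a vertex, counting itself, is at
  most its value \<open>(1 + a) / (1 - d a)\<close> on the regular tree. Trivially, the influences are also
  controlled by the number \<open>n\<close> of vertices.

  Next, reveal each occupied vertex of a sample at fugacity \<open>\<lambda>\<close> independently with probability
  \<open>1 - t / \<lambda>\<close>. The expected conditional variance of a function \<open>f\<close>, as a function of \<open>t\<close>, vanishes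
  at \<open>0\<close>, equals the variance of \<open>f\<close> at \<open>\<lambda>\<close>, has a multiple of the Dirichlet form as its derivative
  at \<open>0\<close>, and its logarithmic derivative in \<open>ln t\<close> is at most the total influence at \<open>t\<close>.
  Integrating the tree bound up to \<open>1 - d a = 1 / n\<close> costs a factor \<open>n powr (2 \<Delta> / (\<Delta> - 2))\<close>, and
  the bound \<open>n\<close> costs only a constant on the rest of the way. The resulting Poincare inequality
  gives the mixing time in the usual way.\<close>

section \<open>Weighted means and covariances\<close>

definition weighted_mean :: "'b set \<Rightarrow> ('b \<Rightarrow> real) \<Rightarrow> ('b \<Rightarrow> real) \<Rightarrow> real" where
  "weighted_mean \<Omega> \<mu> f = (\<Sum>x\<in>\<Omega>. \<mu> x * f x)"

definition weighted_cov ::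
    "'b set \<Rightarrow> ('b \<Rightarrow> real) \<Rightarrow> ('b \<Rightarrow> real) \<Rightarrow> ('b \<Rightarrow> real) \<Rightarrow> real" where
  "weighted_cov \<Omega> \<mu> f g =
     weighted_mean \<Omega> \<mu> (\<lambda>x. f x * g x) - weighted_mean \<Omega> \<mu> f * weighted_mean \<Omega> \<mu> g"

lemma weighted_mean_add:
  "weighted_mean \<Omega> \<mu> (\<lambda>x. f x + g x) = weighted_mean \<Omega> \<mu> f + weighted_mean \<Omega> \<mu> g"
  by (simp add: weighted_mean_def distrib_left sum.distrib)

lemma weighted_mean_diff:
  "weighted_mean \<Omega> \<mu> (\<lambda>x. f x - g x) = weighted_mean \<Omega> \<mu> f - weighted_mean \<Omega> \<mu> g"
  by (simp add: weighted_mean_def right_diff_distrib sum_subtractf)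

lemma weighted_mean_cmult: "weighted_mean \<Omega> \<mu> (\<lambda>x. c * f x) = c * weighted_mean \<Omega> \<mu> f"
  by (simp add: weighted_mean_def sum_distrib_left mult.left_commute)

lemma weighted_mean_sum:
  "weighted_mean \<Omega> \<mu> (\<lambda>x. \<Sum>v\<in>A. g v x) = (\<Sum>v\<in>A. weighted_mean \<Omega> \<mu> (g v))"
  unfolding weighted_mean_def sum_distrib_left by (rule sum.swap)

lemma weighted_mean_indicator:
  assumes "finite \<Omega>" "y \<in> \<Omega>"
  shows "weighted_mean \<Omega> \<mu> (\<lambda>x. indicator {y} x * f x) = \<mu> y * f y"
proof -
  have "weighted_mean \<Omega> \<mu> (\<lambda>x. indicator {y} x * f x) = (\<Sum>x\<in>\<Omega>. if x = y then \<mu> x * f x else 0)"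
    unfolding weighted_mean_def by (rule sum.cong) auto
  then show ?thesis
    using assms by simp
qed

lemma weighted_cov_commute: "weighted_cov \<Omega> \<mu> f g = weighted_cov \<Omega> \<mu> g f"
  by (simp add: weighted_cov_def mult.commute)

lemma weighted_cov_sum_right:
  "weighted_cov \<Omega> \<mu> f (\<lambda>x. \<Sum>v\<in>A. y v * g v x) = (\<Sum>v\<in>A. y v * weighted_cov \<Omega> \<mu> f (g v))"
proof -
  have "(\<lambda>x. f x * (\<Sum>v\<in>A. y v * g v x)) = (\<lambda>x. \<Sum>v\<in>A. y v * (f x * g v x))"
    by (simp add: sum_distrib_left mult.left_commute)
  then show ?thesis
    unfolding weighted_cov_def
    by (simp only: weighted_mean_sum weighted_mean_cmult right_diff_distrib sum_subtractf)
      (simp add: sum_distrib_left mult.left_commute)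
qed

lemma weighted_cov_diff_self:
  "weighted_cov \<Omega> \<mu> (\<lambda>x. c * f x - g x) (\<lambda>x. c * f x - g x)
    = c\<^sup>2 * weighted_cov \<Omega> \<mu> f f - 2 * c * weighted_cov \<Omega> \<mu> f g + weighted_cov \<Omega> \<mu> g g"
proof -
  have "(\<lambda>x. (c * f x - g x) * (c * f x - g x))
      = (\<lambda>x. c\<^sup>2 * (f x * f x) - 2 * c * (f x * g x) + g x * g x)"
    by (simp add: fun_eq_iff power2_eq_square algebra_simps)
  then show ?thesis
    by (simp add: weighted_cov_def weighted_mean_add weighted_mean_diff weighted_mean_cmult)
      (simp add: power2_eq_square algebra_simps)
qed

locale finite_distribution =
  fixes \<Omega> :: "'b set" and \<mu> :: "'b \<Rightarrow> real"
  assumes finite_space: "finite \<Omega>"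
    and weight_nonneg: "x \<in> \<Omega> \<Longrightarrow> 0 \<le> \<mu> x"
    and sum_weight: "sum \<mu> \<Omega> = 1"
begin

abbreviation mean :: "('b \<Rightarrow> real) \<Rightarrow> real" where
  "mean \<equiv> weighted_mean \<Omega> \<mu>"

abbreviation cov :: "('b \<Rightarrow> real) \<Rightarrow> ('b \<Rightarrow> real) \<Rightarrow> real" where
  "cov \<equiv> weighted_cov \<Omega> \<mu>"

lemma mean_const: "mean (\<lambda>_. c) = c"
  by (simp add: weighted_mean_def sum_weight flip: sum_distrib_right)

lemma mean_mono: "(\<And>x. x \<in> \<Omega> \<Longrightarrow> f x \<le> g x) \<Longrightarrow> mean f \<le> mean g"
  unfolding weighted_mean_def by (intro sum_mono mult_left_mono weight_nonneg)

lemma mean_square_deviation: "mean (\<lambda>x. (f x - mean f)\<^sup>2) = cov f f"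
proof -
  have "(\<lambda>x. (f x - mean f)\<^sup>2) = (\<lambda>x. f x * f x - 2 * mean f * f x + (mean f)\<^sup>2)"
    by (simp add: fun_eq_iff power2_eq_square algebra_simps)
  then show ?thesis
    by (simp add: weighted_cov_def weighted_mean_add weighted_mean_diff weighted_mean_cmult
        mean_const power2_eq_square)
qed

lemma var_nonneg: "0 \<le> cov f f"
  unfolding mean_square_deviation[symmetric]
  using mean_mono[of "\<lambda>_. 0" "\<lambda>x. (f x - mean f)\<^sup>2"] by (simp add: mean_const)

lemma abs_cov_le_mean:
  assumes "\<And>x. x \<in> \<Omega> \<Longrightarrow> 0 \<le> f x" "\<And>x. x \<in> \<Omega> \<Longrightarrow> g x \<in> {0..1}"
  shows "\<bar>cov f g\<bar> \<le> mean f"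
proof -
  have "0 \<le> mean (\<lambda>x. f x * g x)" "mean (\<lambda>x. f x * g x) \<le> mean f" "0 \<le> mean f"
    using mean_mono[of "\<lambda>_. 0" "\<lambda>x. f x * g x"] mean_mono[of "\<lambda>x. f x * g x" f]
      mean_mono[of "\<lambda>_. 0" f] assms by (auto simp: mean_const mult_left_le)
  moreover have "0 \<le> mean g" "mean g \<le> 1"
    using mean_mono[of "\<lambda>_. 0" g] mean_mono[of g "\<lambda>_. 1"] assms(2) by (auto simp: mean_const)
  then have "0 \<le> mean f * mean g" "mean f * mean g \<le> mean f"
    using \<open>0 \<le> mean f\<close> by (auto simp: mult_left_le)
  ultimately show ?thesis
    unfolding weighted_cov_def by linarith
qed

end

lemma quadratic_form_le_abs_row_sums:
  fixes C :: "'v \<Rightarrow> 'v \<Rightarrow> real"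
  assumes sym: "\<And>u v. C u v = C v u" and row: "\<And>u. u \<in> A \<Longrightarrow> (\<Sum>v\<in>A. \<bar>C u v\<bar>) \<le> r u"
  shows "(\<Sum>u\<in>A. \<Sum>v\<in>A. y u * y v * C u v) \<le> (\<Sum>u\<in>A. (y u)\<^sup>2 * r u)"
proof -
  define D where "D u v = (y u)\<^sup>2 * \<bar>C u v\<bar> / 2" for u v
  have "y u * y v * C u v \<le> D u v + D v u" for u v
  proof -
    have "y u * y v * C u v \<le> \<bar>y u\<bar> * \<bar>y v\<bar> * \<bar>C u v\<bar>"
      by (metis abs_ge_self abs_mult)
    also have "\<dots> \<le> ((y u)\<^sup>2 + (y v)\<^sup>2) / 2 * \<bar>C u v\<bar>"
      using sum_squares_bound[of "\<bar>y u\<bar>" "\<bar>y v\<bar>"] by (intro mult_right_mono) auto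
    also have "\<dots> = D u v + D v u"
      unfolding D_def sym[of v u] by (simp add: field_simps)
    finally show ?thesis .
  qed
  then have "(\<Sum>u\<in>A. \<Sum>v\<in>A. y u * y v * C u v) \<le> (\<Sum>u\<in>A. \<Sum>v\<in>A. D u v + D v u)"
    by (intro sum_mono)
  also have "\<dots> = (\<Sum>u\<in>A. \<Sum>v\<in>A. D u v) + (\<Sum>v\<in>A. \<Sum>u\<in>A. D v u)"
    by (simp only: sum.distrib sum.swap[of "\<lambda>u v. D v u"])
  also have "\<dots> = (\<Sum>u\<in>A. (y u)\<^sup>2 * (\<Sum>v\<in>A. \<bar>C u v\<bar>))"
    by (simp add: D_def sum_distrib_left flip: sum_divide_distrib)
  also have "\<dots> \<le> (\<Sum>u\<in>A. (y u)\<^sup>2 * r u)"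
    using row by (intro sum_mono mult_left_mono) auto
  finally show ?thesis .
qed

lemma (in finite_distribution) sum_cov_squares_le:
  assumes "\<eta> > 0" and pos: "\<And>v. v \<in> A \<Longrightarrow> mean (X v) > 0"
    and row: "\<And>u. u \<in> A \<Longrightarrow> (\<Sum>v\<in>A. \<bar>cov (X u) (X v)\<bar>) \<le> \<eta> * mean (X u)"
  shows "(\<Sum>v\<in>A. (cov f (X v))\<^sup>2 / mean (X v)) \<le> \<eta> * cov f f"
proof -
  define y where "y v = cov f (X v) / mean (X v)" for v
  define g where "g x = (\<Sum>v\<in>A. y v * X v x)" for x
  define Q where "Q = (\<Sum>v\<in>A. (cov f (X v))\<^sup>2 / mean (X v))"
  have cov_f_g: "cov f g = Q"
    unfolding g_def[abs_def] weighted_cov_sum_right by (simp add: Q_def y_def power2_eq_square)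
  have "cov g (X u) = (\<Sum>v\<in>A. y v * cov (X u) (X v))" for u
    unfolding weighted_cov_commute[of _ _ g] unfolding g_def[abs_def]
    by (rule weighted_cov_sum_right)
  moreover have "cov g g = (\<Sum>u\<in>A. y u * cov g (X u))"
    unfolding g_def[abs_def] by (rule weighted_cov_sum_right)
  ultimately have "cov g g = (\<Sum>u\<in>A. \<Sum>v\<in>A. y u * y v * cov (X u) (X v))"
    by (simp add: sum_distrib_left mult.assoc)
  also have "\<dots> \<le> (\<Sum>u\<in>A. (y u)\<^sup>2 * (\<eta> * mean (X u)))"
    using row by (intro quadratic_form_le_abs_row_sums weighted_cov_commute)
  also have "\<dots> = \<eta> * Q"
    unfolding Q_def sum_distrib_left
    by (intro sum.cong refl) (use pos in \<open>fastforce simp: y_def power2_eq_square\<close>)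
  finally have var_g_le: "cov g g \<le> \<eta> * Q" .
  have "0 \<le> cov (\<lambda>x. \<eta> * f x - g x) (\<lambda>x. \<eta> * f x - g x)"
    by (rule var_nonneg)
  then have "0 \<le> \<eta>\<^sup>2 * cov f f - 2 * \<eta> * Q + \<eta> * Q"
    unfolding weighted_cov_diff_self cov_f_g using var_g_le by linarith
  then have "\<eta> * Q \<le> \<eta> * (\<eta> * cov f f)"
    by (simp add: power2_eq_square algebra_simps)
  then show ?thesis
    using \<open>\<eta> > 0\<close> by (simp add: Q_def)
qed

section \<open>Mixing times of reversible chains\<close>

locale reversible_chain = finite_distribution \<Omega> \<mu>
  for \<Omega> :: "'s set" and \<mu> :: "'s \<Rightarrow> real" +
  fixes P :: "'s \<Rightarrow> 's pmf"
  assumes weight_pos: "x \<in> \<Omega> \<Longrightarrow> 0 < \<mu> x"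
    and set_step_subset: "x \<in> \<Omega> \<Longrightarrow> set_pmf (P x) \<subseteq> \<Omega>"
    and detailed_balance: "x \<in> \<Omega> \<Longrightarrow> y \<in> \<Omega> \<Longrightarrow> \<mu> x * pmf (P x) y = \<mu> y * pmf (P y) x"
begin

definition transition_op :: "('s \<Rightarrow> real) \<Rightarrow> 's \<Rightarrow> real" where
  "transition_op f x = measure_pmf.expectation (P x) f"

definition dirichlet :: "('s \<Rightarrow> real) \<Rightarrow> real" where
  "dirichlet f = mean (\<lambda>x. f x * f x) - mean (\<lambda>x. f x * transition_op f x)"

definition density :: "'s \<Rightarrow> nat \<Rightarrow> 's \<Rightarrow> real" where
  "density x t y = pmf (iterate_kernel P t x) y / \<mu> y"

lemma transition_op_eq_sum:
  assumes "x \<in> \<Omega>"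
  shows "transition_op f x = (\<Sum>y\<in>\<Omega>. f y * pmf (P x) y)"
  unfolding transition_op_def using set_step_subset[OF assms]
  by (intro integral_measure_pmf_real) (auto simp: finite_space)

lemma mean_transition_op: "mean (transition_op f) = mean f"
proof -
  have "mean (transition_op f) = (\<Sum>x\<in>\<Omega>. \<Sum>y\<in>\<Omega>. f y * (\<mu> x * pmf (P x) y))"
    by (simp add: weighted_mean_def transition_op_eq_sum sum_distrib_left mult.left_commute
        cong: sum.cong)
  also have "\<dots> = (\<Sum>y\<in>\<Omega>. \<Sum>x\<in>\<Omega>. f y * (\<mu> y * pmf (P y) x))"
    by (subst sum.swap) (simp add: detailed_balance cong: sum.cong)
  also have "\<dots> = (\<Sum>y\<in>\<Omega>. f y * (\<mu> y * (\<Sum>x\<in>\<Omega>. pmf (P y) x)))"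
    by (simp add: sum_distrib_left)
  also have "\<dots> = mean f"
    using finite_space set_step_subset by (simp add: weighted_mean_def sum_pmf_eq_1 mult.commute)
  finally show ?thesis .
qed

lemma set_iterate_subset: "x \<in> \<Omega> \<Longrightarrow> set_pmf (iterate_kernel P t x) \<subseteq> \<Omega>"
  by (induction t) (use set_step_subset in fastforce)+

lemma mean_density: "x \<in> \<Omega> \<Longrightarrow> mean (density x t) = 1"
  using sum_pmf_eq_1[OF finite_space set_iterate_subset[of x t]] weight_pos
  by (simp add: weighted_mean_def density_def less_imp_neq[symmetric] cong: sum.cong)

lemma density_Suc:
  assumes "x \<in> \<Omega>" "y \<in> \<Omega>"
  shows "density x (Suc t) y = transition_op (density x t) y"
proof -
  let ?p = "pmf (iterate_kernel P t x)"
  have "pmf (iterate_kernel P (Suc t) x) y = (\<Sum>z\<in>\<Omega>. pmf (P z) y * ?p z)"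
    using set_iterate_subset[OF assms(1)]
    by (simp add: pmf_bind) (intro integral_measure_pmf_real, auto simp: finite_space)
  also have "\<dots> = (\<Sum>z\<in>\<Omega>. \<mu> y * (density x t z * pmf (P y) z))"
  proof (rule sum.cong[OF refl])
    fix z assume z_in: "z \<in> \<Omega>"
    have "pmf (P z) y = \<mu> y * pmf (P y) z / \<mu> z"
      using detailed_balance[OF z_in assms(2)] weight_pos[OF z_in] by (simp add: field_simps)
    then show "pmf (P z) y * ?p z = \<mu> y * (density x t z * pmf (P y) z)"
      by (simp add: density_def)
  qed
  also have "\<dots> = \<mu> y * transition_op (density x t) y"
    by (simp add: transition_op_eq_sum[OF assms(2)] sum_distrib_left)
  finally show ?thesis
    using weight_pos[OF assms(2)] by (simp add: density_def)
qed

lemma var_density_0_le: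
  assumes "x \<in> \<Omega>"
  shows "cov (density x 0) (density x 0) \<le> 1 / \<mu> x"
proof -
  have "(\<lambda>y. density x 0 y * density x 0 y) = (\<lambda>y. indicator {x} y * (1 / (\<mu> x)\<^sup>2))"
    by (auto simp: fun_eq_iff density_def indicator_def power2_eq_square)
  then have "mean (\<lambda>y. density x 0 y * density x 0 y) = 1 / \<mu> x"
    using weighted_mean_indicator[OF finite_space assms, of \<mu> "\<lambda>_. 1 / (\<mu> x)\<^sup>2"]
    by (simp add: power2_eq_square)
  then show ?thesis
    by (simp add: weighted_cov_def mean_density[OF assms])
qed

lemma tv_dist_le_var_density:
  assumes "x \<in> \<Omega>"
  shows "(2 * tv_dist \<Omega> (pmf (iterate_kernel P t x)) \<mu>)\<^sup>2 \<le> cov (density x t) (density x t)"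
proof -
  let ?dev = "\<lambda>y. density x t y - mean (density x t)"
  have "\<bar>pmf (iterate_kernel P t x) y - \<mu> y\<bar> = \<mu> y * \<bar>?dev y\<bar>" if "y \<in> \<Omega>" for y
  proof -
    have "pmf (iterate_kernel P t x) y - \<mu> y = \<mu> y * ?dev y"
      using weight_pos[OF that] by (simp add: mean_density[OF assms] density_def field_simps)
    then show ?thesis
      using weight_pos[OF that] by (simp add: abs_mult)
  qed
  then have "2 * tv_dist \<Omega> (pmf (iterate_kernel P t x)) \<mu> = mean (\<lambda>y. \<bar>?dev y\<bar>)"
    by (simp add: tv_dist_def weighted_mean_def)
  also have "(mean (\<lambda>y. \<bar>?dev y\<bar>))\<^sup>2 \<le> mean (\<lambda>y. (?dev y)\<^sup>2)"
    using var_nonneg[of "\<lambda>y. \<bar>?dev y\<bar>"] by (simp add: weighted_cov_def power2_eq_square)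
  finally show ?thesis
    by (simp only: mean_square_deviation)
qed

end

lemma mixing_time_le:
  assumes "finite \<Omega>" "\<Omega> \<noteq> {}"
    and close: "\<And>x. x \<in> \<Omega> \<Longrightarrow> tv_dist \<Omega> (pmf (iterate_kernel P T x)) \<mu> \<le> 1 / 4"
  shows "mixing_time \<Omega> P \<mu> \<le> enat T"
  unfolding mixing_time_def
proof (rule Max.boundedI)
  fix m assume "m \<in> (\<lambda>x. INF t\<in>{t. tv_dist \<Omega> (pmf (iterate_kernel P t x)) \<mu> \<le> 1 / 4}. enat t) ` \<Omega>"
  then show "m \<le> enat T"
    using close by (auto intro: INF_lower)
qed (use assms in auto)

locale poincare_chain = reversible_chain +
  fixes \<Gamma> :: real
  assumes relaxation_ge_1: "1 \<le> \<Gamma>"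
    and transition_op_contracting:
      "mean (\<lambda>x. transition_op f x * transition_op f x) \<le> mean (\<lambda>x. f x * transition_op f x)"
    and poincare: "cov f f \<le> \<Gamma> * dirichlet f"
begin

lemma var_transition_op_le: "cov (transition_op f) (transition_op f) \<le> (1 - 1 / \<Gamma>) * cov f f"
proof -
  have "cov (transition_op f) (transition_op f) \<le> cov f f - dirichlet f"
    using transition_op_contracting[of f]
    by (simp add: weighted_cov_def dirichlet_def mean_transition_op)
  also have "\<dots> \<le> cov f f - cov f f / \<Gamma>"
    using poincare[of f] relaxation_ge_1 by (simp add: field_simps)
  finally show ?thesis
    by (simp add: algebra_simps)
qed

lemma var_density_le:
  assumes "x \<in> \<Omega>"
  shows "cov (density x t) (density x t) \<le> (1 - 1 / \<Gamma>) ^ t / \<mu> x"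
proof (induction t)
  case 0
  show ?case using var_density_0_le[OF assms] by simp
next
  case (Suc t)
  have "cov (density x (Suc t)) (density x (Suc t))
      = cov (transition_op (density x t)) (transition_op (density x t))"
    by (simp add: weighted_cov_def weighted_mean_def density_Suc[OF assms] cong: sum.cong)
  also have "\<dots> \<le> (1 - 1 / \<Gamma>) * cov (density x t) (density x t)"
    by (rule var_transition_op_le)
  also have "\<dots> \<le> (1 - 1 / \<Gamma>) * ((1 - 1 / \<Gamma>) ^ t / \<mu> x)"
    using Suc relaxation_ge_1 by (intro mult_left_mono) auto
  finally show ?case by simp
qed

lemma tv_dist_le_quarter:
  assumes "x \<in> \<Omega>" "\<Gamma> * ln (4 / \<mu> x) \<le> real T"
  shows "tv_dist \<Omega> (pmf (iterate_kernel P T x)) \<mu> \<le> 1 / 4"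
proof -
  have weight_x_pos: "\<mu> x > 0" using assms(1) by (rule weight_pos)
  have "(1 - 1 / \<Gamma>) ^ T \<le> exp (- 1 / \<Gamma>) ^ T"
    using relaxation_ge_1 exp_ge_add_one_self[of "- 1 / \<Gamma>"] by (intro power_mono) auto
  also have "\<dots> = exp (- (real T / \<Gamma>))"
    by (simp flip: exp_of_nat_mult)
  also have "\<dots> \<le> exp (- ln (4 / \<mu> x))"
    using assms(2) relaxation_ge_1 by (simp add: pos_le_divide_eq mult.commute)
  also have "\<dots> = \<mu> x / 4"
    using weight_x_pos by (simp add: exp_minus)
  finally have "(1 - 1 / \<Gamma>) ^ T / \<mu> x \<le> (1 / 2)\<^sup>2"
    using weight_x_pos by (simp add: field_simps power2_eq_square)
  then have "(2 * tv_dist \<Omega> (pmf (iterate_kernel P T x)) \<mu>)\<^sup>2 \<le> (1 / 2)\<^sup>2"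
    using tv_dist_le_var_density[OF assms(1), of T] var_density_le[OF assms(1), of T] by linarith
  then show ?thesis
    using power2_le_imp_le[of "2 * tv_dist \<Omega> (pmf (iterate_kernel P T x)) \<mu>" "1 / 2"] by simp
qed

lemma mixing_time_le_poincare:
  assumes "\<Omega> \<noteq> {}" "1 \<le> L" "\<And>x. x \<in> \<Omega> \<Longrightarrow> ln (4 / \<mu> x) \<le> L"
  shows "ereal_of_enat (mixing_time \<Omega> P \<mu>) \<le> ereal (2 * \<Gamma> * L)"
proof -
  define T where "T = nat \<lceil>\<Gamma> * L\<rceil>"
  have "1 \<le> \<Gamma> * L"
    using mult_mono[of 1 \<Gamma> 1 L] relaxation_ge_1 assms(2) by simp
  then have T_bounds: "\<Gamma> * L \<le> real T" "real T \<le> 2 * \<Gamma> * L"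
    unfolding T_def by linarith+
  have "mixing_time \<Omega> P \<mu> \<le> enat T"
  proof (rule mixing_time_le[OF finite_space assms(1) tv_dist_le_quarter])
    show "\<Gamma> * ln (4 / \<mu> x) \<le> real T" if "x \<in> \<Omega>" for x
      using mult_left_mono[OF assms(3)[OF that], of \<Gamma>] relaxation_ge_1 T_bounds(1) by linarith
  qed
  then have "ereal_of_enat (mixing_time \<Omega> P \<mu>) \<le> ereal (real T)"
    using ereal_of_enat_le_iff[of _ "enat T"] by simp
  also have "\<dots> \<le> ereal (2 * \<Gamma> * L)"
    using T_bounds(2) by simp
  finally show ?thesis .
qed

end

section \<open>Differential inequalities\<close>

lemma gronwall:
  fixes W G :: "real \<Rightarrow> real"
  assumes "s \<le> b"
    and W_deriv: "\<And>t. s \<le> t \<Longrightarrow> t \<le> b \<Longrightarrow> (W has_real_derivative W' t) (at t)"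
    and G_deriv: "\<And>t. s \<le> t \<Longrightarrow> t \<le> b \<Longrightarrow> (G has_real_derivative G' t) (at t)"
    and deriv_le: "\<And>t. s \<le> t \<Longrightarrow> t \<le> b \<Longrightarrow> W' t \<le> G' t * W t"
  shows "W b \<le> exp (G b - G s) * W s"
proof -
  have "W b * exp (- G b) \<le> W s * exp (- G s)"
  proof (rule DERIV_nonpos_imp_nonincreasing[OF \<open>s \<le> b\<close>])
    fix t assume t_range: "s \<le> t" "t \<le> b"
    have "((\<lambda>t. W t * exp (- G t)) has_real_derivative (W' t - G' t * W t) * exp (- G t)) (at t)"
      by (rule derivative_eq_intros W_deriv[OF t_range] G_deriv[OF t_range] refl
        | simp add: algebra_simps)+
    moreover have "(W' t - G' t * W t) * exp (- G t) \<le> 0"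
      using deriv_le[OF t_range] by (intro mult_nonpos_nonneg) auto
    ultimately show "\<exists>y. ((\<lambda>t. W t * exp (- G t)) has_real_derivative y) (at t) \<and> y \<le> 0"
      by blast
  qed
  then show ?thesis
    by (simp add: exp_diff exp_minus field_simps)
qed

lemma gronwall_from_zero:
  fixes U H :: "real \<Rightarrow> real"
  assumes "0 < b" "U 0 = 0" and U_deriv_0: "(U has_real_derivative D) (at 0)"
    and H_cont: "isCont H 0"
    and U_deriv: "\<And>a. 0 < a \<Longrightarrow> a \<le> b \<Longrightarrow> (U has_real_derivative U' a) (at a)"
    and H_deriv: "\<And>a. 0 < a \<Longrightarrow> a \<le> b \<Longrightarrow> (H has_real_derivative H' a) (at a)"
    and deriv_le: "\<And>a. 0 < a \<Longrightarrow> a \<le> b \<Longrightarrow> U' a \<le> (1 / a + H' a) * U a"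
  shows "U b \<le> b * exp (H b - H 0) * D"
proof -
  have "U b \<le> b * exp (H b - H a) * (U a / a)" if a_range: "0 < a" "a < b" for a
  proof -
    have "U b \<le> exp ((ln b + H b) - (ln a + H a)) * U a"
    proof (rule gronwall[where G = "\<lambda>a. ln a + H a" and G' = "\<lambda>a. 1 / a + H' a" and W' = U'])
      show "((\<lambda>a. ln a + H a) has_real_derivative 1 / t + H' t) (at t)" if "a \<le> t" "t \<le> b" for t
        using that a_range by (intro DERIV_add DERIV_ln_divide H_deriv) auto
    qed (use a_range U_deriv deriv_le in auto)
    also have "(ln b + H b) - (ln a + H a) = ln b - ln a + (H b - H a)"
      by simp
    finally show ?thesis
      using a_range by (simp add: exp_add exp_diff field_simps)
  qed
  then have "\<forall>\<^sub>F a in at_right 0. U b \<le> b * exp (H b - H a) * (U a / a)"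
    using \<open>0 < b\<close> by (auto simp: eventually_at_right_field)
  moreover have "((\<lambda>a. U a / a) \<longlongrightarrow> D) (at_right 0)"
    using U_deriv_0 \<open>U 0 = 0\<close> by (auto simp: has_field_derivative_iff intro: filterlim_mono at_le)
  moreover have "(H \<longlongrightarrow> H 0) (at_right 0)"
    using H_cont by (auto simp: isCont_def intro: filterlim_mono at_le)
  ultimately show ?thesis
    by (intro tendsto_lowerbound[where F = "at_right 0"
      and f = "\<lambda>a. b * exp (H b - H a) * (U a / a)"]
        tendsto_intros) auto
qed

section \<open>The hardcore model\<close>

locale finite_simple_graph =
  fixes V :: "'a set" and E :: "'a set set"
  assumes simple: "simple_graph V E"
begin

definition nbhd :: "'a \<Rightarrow> 'a set" where
  "nbhd v = {u. {u, v} \<in> E}"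

abbreviation closed_nbhd :: "'a \<Rightarrow> 'a set" where
  "closed_nbhd v \<equiv> insert v (nbhd v)"

abbreviation ind :: "'a set \<Rightarrow> 'a set set" where
  "ind U \<equiv> independent_sets U E"

abbreviation Z :: "real \<Rightarrow> 'a set \<Rightarrow> real" where
  "Z t U \<equiv> partition_fun U E t"

abbreviation gibbs_mean :: "real \<Rightarrow> 'a set \<Rightarrow> ('a set \<Rightarrow> real) \<Rightarrow> real" where
  "gibbs_mean t U \<equiv> weighted_mean (ind U) (hardcore U E t)"

abbreviation gibbs_cov :: "real \<Rightarrow> 'a set \<Rightarrow> ('a set \<Rightarrow> real) \<Rightarrow> ('a set \<Rightarrow> real) \<Rightarrow> real" where
  "gibbs_cov t U \<equiv> weighted_cov (ind U) (hardcore U E t)"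

abbreviation occupied :: "'a \<Rightarrow> 'a set \<Rightarrow> real" where
  "occupied v \<equiv> \<lambda>S. of_bool (v \<in> S)"

definition gibbs_sum :: "real \<Rightarrow> 'a set \<Rightarrow> ('a set \<Rightarrow> real) \<Rightarrow> real" where
  "gibbs_sum t U f = (\<Sum>S\<in>ind U. t ^ card S * f S)"

definition marg :: "real \<Rightarrow> 'a set \<Rightarrow> 'a \<Rightarrow> real" where
  "marg t U v = gibbs_mean t U (occupied v)"

lemma finite_V: "finite V"
  using simple by (simp add: simple_graph_def)

lemma nbhd_sym: "u \<in> nbhd v \<longleftrightarrow> v \<in> nbhd u"
  by (simp add: nbhd_def insert_commute)

lemma not_self_nbhd: "v \<notin> nbhd v"
  using simple by (force simp: nbhd_def simple_graph_def)

lemma nbhd_subset: "nbhd v \<subseteq> V"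
  using simple by (auto simp: nbhd_def simple_graph_def)

lemma finite_nbhd: "finite (nbhd v)"
  using nbhd_subset finite_V by (rule finite_subset)

lemma card_nbhd: "card (nbhd v) = vertex_degree E v"
proof -
  have "bij_betw (\<lambda>u. {u, v}) (nbhd v) {e \<in> E. v \<in> e}"
  proof (rule bij_betwI')
    show "({x, v} = {y, v}) = (x = y)" if "x \<in> nbhd v" "y \<in> nbhd v" for x y
      using that not_self_nbhd by (auto simp: doubleton_eq_iff)
    show "{x, v} \<in> {e \<in> E. v \<in> e}" if "x \<in> nbhd v" for x
      using that by (simp add: nbhd_def)
    show "\<exists>x\<in>nbhd v. e = {x, v}" if "e \<in> {e \<in> E. v \<in> e}" for e
    proof -
      have "card e = 2" "v \<in> e" "e \<in> E"
        using that simple by (auto simp: simple_graph_def)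
      then obtain x where "e = {x, v}"
        by (auto simp: card_2_iff)
      with \<open>e \<in> E\<close> show ?thesis by (auto simp: nbhd_def)
    qed
  qed
  then show ?thesis by (simp add: vertex_degree_def bij_betw_same_card)
qed

lemma card_nbhd_le_max_degree: "card (nbhd v) \<le> max_degree V E"
proof (cases "v \<in> V")
  case True
  then show ?thesis
    unfolding max_degree_def card_nbhd using finite_V by (intro Max_ge) auto
next
  case False
  then have "nbhd v = {}"
    using simple by (auto simp: nbhd_def simple_graph_def)
  then show ?thesis by simp
qed

lemma max_degree_less_card:
  assumes "V \<noteq> {}"
  shows "max_degree V E < card V"
proof -
  have "card (nbhd v) < card V" if "v \<in> V" for v
    using that nbhd_subset not_self_nbhd finite_V by (intro psubset_card_mono) auto
  then show ?thesis
    using assms finite_V by (simp add: max_degree_def card_nbhd card_gt_0_iff)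
qed

lemma ind_iff: "S \<in> ind U \<longleftrightarrow> S \<subseteq> U \<and> (\<forall>v\<in>S. S \<inter> nbhd v = {})"
  by (auto simp: independent_sets_def nbhd_def)

lemma finite_ind: "finite U \<Longrightarrow> finite (ind U)"
  by (rule finite_subset[of _ "Pow U"]) (auto simp: ind_iff)

lemma finite_mem_ind: "finite U \<Longrightarrow> S \<in> ind U \<Longrightarrow> finite S"
  by (auto simp: ind_iff intro: finite_subset)

lemma empty_in_ind: "{} \<in> ind U"
  by (simp add: ind_iff)

lemma insert_in_ind_iff:
  "insert w S \<in> ind U \<longleftrightarrow> w \<in> U \<and> S \<in> ind U \<and> S \<inter> nbhd w = {}"
  using not_self_nbhd nbhd_sym by (auto simp: ind_iff)

lemma ind_containing:
  assumes "w \<in> U"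
  shows "{S \<in> ind U. w \<in> S} = insert w ` ind (U - closed_nbhd w)"
proof (intro equalityI subsetI)
  fix S assume S_in: "S \<in> {S \<in> ind U. w \<in> S}"
  then have "S = insert w (S - {w})" by auto
  moreover have "S - {w} \<in> ind (U - closed_nbhd w)"
    using S_in by (auto simp: ind_iff)
  ultimately show "S \<in> insert w ` ind (U - closed_nbhd w)" by blast
next
  fix S assume "S \<in> insert w ` ind (U - closed_nbhd w)"
  then obtain T where T_in: "T \<in> ind (U - closed_nbhd w)" "S = insert w T" by auto
  then have "T \<in> ind U" "T \<inter> nbhd w = {}" by (auto simp: ind_iff)
  then show "S \<in> {S \<in> ind U. w \<in> S}" using T_in assms by (simp add: insert_in_ind_iff)
qed

lemma ind_avoiding: "{S \<in> ind U. w \<notin> S} = ind (U - {w})"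
  by (rule set_eqI, unfold mem_Collect_eq ind_iff) blast

lemma sum_ind_containing:
  assumes "w \<in> U"
  shows "(\<Sum>S | S \<in> ind U \<and> w \<in> S. g S) = (\<Sum>S\<in>ind (U - closed_nbhd w). g (insert w S))"
proof -
  have "inj_on (insert w) (ind (U - closed_nbhd w))"
    by (rule inj_onI) (auto simp: ind_iff)
  then show ?thesis
    using ind_containing[OF assms] by (simp add: sum.reindex o_def)
qed

lemma card_insert_ind:
  "finite U \<Longrightarrow> S \<in> ind (U - insert w X) \<Longrightarrow> card (insert w S) = Suc (card S)"
  using finite_mem_ind[of "U - insert w X" S] by (auto simp: ind_iff card_insert_if)

lemma gibbs_sum_one: "gibbs_sum t U (\<lambda>_. 1) = Z t U"
  by (simp add: gibbs_sum_def partition_fun_def)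

lemma gibbs_sum_occupied:
  assumes "finite U" "w \<in> U"
  shows "gibbs_sum t U (\<lambda>S. occupied w S * f S)
    = t * gibbs_sum t (U - closed_nbhd w) (f \<circ> insert w)"
proof -
  have "gibbs_sum t U (\<lambda>S. occupied w S * f S) = (\<Sum>S | S \<in> ind U \<and> w \<in> S. t ^ card S * f S)"
    unfolding gibbs_sum_def
    by (rule sum.mono_neutral_cong_right) (use finite_ind assms in auto)
  also have "\<dots> = (\<Sum>S\<in>ind (U - closed_nbhd w). t * (t ^ card S * f (insert w S)))"
    unfolding sum_ind_containing[OF assms(2)]
    by (rule sum.cong) (simp_all add: card_insert_ind[OF assms(1)] mult.assoc)
  finally show ?thesis by (simp add: gibbs_sum_def sum_distrib_left)
qed

lemma gibbs_sum_split:
  assumes "finite U" "w \<in> U"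
  shows "gibbs_sum t U f
    = gibbs_sum t (U - {w}) f + t * gibbs_sum t (U - closed_nbhd w) (f \<circ> insert w)"
proof -
  have "gibbs_sum t (U - {w}) f = gibbs_sum t U (\<lambda>S. of_bool (w \<notin> S) * f S)"
    unfolding gibbs_sum_def ind_avoiding[symmetric]
    by (rule sum.mono_neutral_cong_left) (use finite_ind assms in auto)
  moreover have "gibbs_sum t U (\<lambda>S. of_bool (w \<notin> S) * f S) + gibbs_sum t U (\<lambda>S. occupied w S * f S)
      = gibbs_sum t U f"
    unfolding gibbs_sum_def sum.distrib[symmetric] by (rule sum.cong) auto
  ultimately show ?thesis
    unfolding gibbs_sum_occupied[OF assms] by simp
qed

lemma gibbs_sum_0:
  assumes "finite U"
  shows "gibbs_sum 0 U f = f {}"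
proof -
  have "gibbs_sum 0 U f = (\<Sum>S\<in>{{}}. 0 ^ card S * f S)"
    unfolding gibbs_sum_def
    by (rule sum.mono_neutral_right)
      (use assms finite_ind empty_in_ind finite_mem_ind in \<open>auto simp: card_gt_0_iff\<close>)
  then show ?thesis by simp
qed

lemma gibbs_mean_eq: "gibbs_mean t U f = gibbs_sum t U f / Z t U"
  by (simp add: weighted_mean_def gibbs_sum_def hardcore_def sum_divide_distrib cong: sum.cong)

lemma Z_pos:
  assumes "finite U" "0 \<le> t"
  shows "0 < Z t U"
  unfolding partition_fun_def
  by (rule sum_pos2[OF finite_ind empty_in_ind]) (use assms in auto)

lemma Z_le:
  assumes "finite U" "0 \<le> t"
  shows "Z t U \<le> (1 + t) ^ card U"
proof -
  have "Z t U \<le> (\<Sum>S\<in>Pow U. t ^ card S)"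
    unfolding partition_fun_def by (rule sum_mono2) (use assms in \<open>auto simp: ind_iff\<close>)
  also have "\<dots> = (1 + t) ^ card U"
    using prod_add[OF assms(1), of "\<lambda>_. t" "\<lambda>_. 1"] by (simp add: add.commute)
  finally show ?thesis .
qed

lemma hardcore_pos: "finite U \<Longrightarrow> 0 < t \<Longrightarrow> S \<in> ind U \<Longrightarrow> 0 < hardcore U E t S"
  by (simp add: hardcore_def Z_pos)

lemma hardcore_ge:
  assumes "finite U" "0 < t" "S \<in> ind U"
  shows "(min 1 t / (1 + t)) ^ card U \<le> hardcore U E t S"
proof -
  have "min 1 t ^ card U \<le> min 1 t ^ card S"
    using assms card_mono[OF assms(1), of S] by (intro power_decreasing) (auto simp: ind_iff)
  also have "\<dots> \<le> t ^ card S"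
    using assms by (intro power_mono) auto
  finally show ?thesis
    unfolding power_divide hardcore_def using assms Z_pos Z_le
    by (simp add: frac_le)
qed

lemma ln_inverse_hardcore_le:
  assumes "finite U" "0 < t" "S \<in> ind U"
  shows "- ln (hardcore U E t S) \<le> real (card U) * ln ((1 + t) / min 1 t)"
proof -
  have "- ln (hardcore U E t S) \<le> - ln ((min 1 t / (1 + t)) ^ card U)"
    using hardcore_ge[OF assms] hardcore_pos[OF assms] assms(2) by simp
  also have "\<dots> = real (card U) * ln ((1 + t) / min 1 t)"
    using assms(2) by (simp add: ln_realpow ln_div algebra_simps)
  finally show ?thesis .
qed

lemma finite_distribution_hardcore:
  assumes "finite U" "0 \<le> t"
  shows "finite_distribution (ind U) (hardcore U E t)"
proof
  show "0 \<le> hardcore U E t S" for S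
    using assms Z_pos[OF assms] by (simp add: hardcore_def)
  show "sum (hardcore U E t) (ind U) = 1"
    using Z_pos[OF assms]
    by (simp add: hardcore_def partition_fun_def flip: sum_divide_distrib cong: sum.cong)
qed (rule finite_ind[OF assms(1)])

lemma marg_eq:
  assumes "finite U" "w \<in> U"
  shows "marg t U w = t * Z t (U - closed_nbhd w) / Z t U"
  using gibbs_sum_occupied[OF assms, of t "\<lambda>_. 1"]
  by (simp add: marg_def gibbs_mean_eq gibbs_sum_one comp_def)

lemma marg_outside: "v \<notin> U \<Longrightarrow> marg t U v = 0"
  unfolding marg_def weighted_mean_def by (rule sum.neutral) (auto simp: ind_iff)

lemma one_minus_marg:
  assumes "finite U" "w \<in> U" "0 \<le> t"
  shows "1 - marg t U w = Z t (U - {w}) / Z t U"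
proof -
  have "Z t U = Z t (U - {w}) + t * Z t (U - closed_nbhd w)"
    using gibbs_sum_split[OF assms(1,2), of t "\<lambda>_. 1"] by (simp add: gibbs_sum_one comp_def)
  then show ?thesis
    using Z_pos[OF assms(1,3)] by (simp add: marg_eq[OF assms(1,2)] field_simps)
qed

lemma marg_bounds:
  assumes "finite U" "0 \<le> t"
  shows "0 \<le> marg t U w" "marg t U w < 1"
proof -
  have "0 \<le> marg t U w \<and> marg t U w < 1"
  proof (cases "w \<in> U")
    case True
    have "0 < 1 - marg t U w"
      unfolding one_minus_marg[OF assms(1) True assms(2)] using assms by (simp add: Z_pos)
    moreover have "0 \<le> marg t U w"
      unfolding marg_eq[OF assms(1) True] using assms by (simp add: Z_pos less_imp_le)
    ultimately show ?thesis by simp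
  qed (simp add: marg_outside)
  then show "0 \<le> marg t U w" "marg t U w < 1" by simp_all
qed

lemma marg_pos: "finite U \<Longrightarrow> w \<in> U \<Longrightarrow> 0 < t \<Longrightarrow> 0 < marg t U w"
  by (simp add: marg_eq Z_pos)

lemma gibbs_mean_occupied:
  assumes "finite U" "w \<in> U" "0 \<le> t"
  shows "gibbs_mean t U (\<lambda>S. occupied w S * f S)
    = marg t U w * gibbs_mean t (U - closed_nbhd w) (f \<circ> insert w)"
  using assms Z_pos[of "U - closed_nbhd w" t]
  by (simp add: gibbs_mean_eq gibbs_sum_occupied marg_eq)

lemma gibbs_mean_split:
  assumes "finite U" "w \<in> U" "0 \<le> t"
  shows "gibbs_mean t U f = marg t U w * gibbs_mean t (U - closed_nbhd w) (f \<circ> insert w)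
    + (1 - marg t U w) * gibbs_mean t (U - {w}) f"
  unfolding one_minus_marg[OF assms] unfolding marg_eq[OF assms(1,2)]
  using assms Z_pos[of _ t]
  by (simp add: gibbs_mean_eq gibbs_sum_split[OF assms(1,2), of t f]
    add_divide_distrib less_imp_neq[symmetric])

lemma gibbs_mean_occupied_insert:
  assumes "finite U" "0 \<le> t"
  shows "gibbs_mean t (U - closed_nbhd w) (occupied v \<circ> insert w)
    = of_bool (v = w) + marg t (U - closed_nbhd w) v"
proof -
  interpret finite_distribution "ind (U - closed_nbhd w)" "hardcore (U - closed_nbhd w) E t"
    using assms by (intro finite_distribution_hardcore) auto
  have "gibbs_mean t (U - closed_nbhd w) (occupied v \<circ> insert w)
      = gibbs_mean t (U - closed_nbhd w) (\<lambda>S. of_bool (v = w) + occupied v S)"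
    unfolding weighted_mean_def by (rule sum.cong) (auto simp: ind_iff)
  then show ?thesis
    by (simp add: weighted_mean_add mean_const marg_def)
qed

lemma marg_split:
  assumes "finite U" "w \<in> U" "0 \<le> t"
  shows "marg t U v = marg t U w * (of_bool (v = w) + marg t (U - closed_nbhd w) v)
    + (1 - marg t U w) * marg t (U - {w}) v"
  using gibbs_mean_split[OF assms, of "occupied v"] assms
  by (simp only: gibbs_mean_occupied_insert) (simp only: marg_def)

section \<open>Total influence\<close>

definition marg_dist :: "real \<Rightarrow> 'a set \<Rightarrow> 'a set \<Rightarrow> real" where
  "marg_dist t U W = (\<Sum>v\<in>V. \<bar>marg t U v - marg t W v\<bar>)"

definition total_influence :: "real \<Rightarrow> 'a set \<Rightarrow> 'a \<Rightarrow> real" where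
  "total_influence t U w = marg_dist t (U - {w}) (U - closed_nbhd w)"

lemma marg_dist_triangle: "marg_dist t U X \<le> marg_dist t U W + marg_dist t W X"
  unfolding marg_dist_def sum.distrib[symmetric] by (rule sum_mono) simp

lemma marg_dist_remove:
  assumes "U \<subseteq> V" "w \<in> U" "0 \<le> t"
  shows "marg_dist t U (U - {w}) = marg t U w * (1 + total_influence t U w)"
proof -
  have fin_U: "finite U"
    using assms(1) finite_V by (rule finite_subset)
  let ?p = "marg t U w" and ?diff = "\<lambda>v. marg t (U - {w}) v - marg t (U - closed_nbhd w) v"
  have "\<bar>marg t U v - marg t (U - {w}) v\<bar> = ?p * (of_bool (v = w) + \<bar>?diff v\<bar>)" for v
  proof -
    have "marg t U v - marg t (U - {w}) v = ?p * (of_bool (v = w) - ?diff v)"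
      using marg_split[OF fin_U assms(2,3), of v] by (simp add: algebra_simps)
    then have "\<bar>marg t U v - marg t (U - {w}) v\<bar> = ?p * \<bar>of_bool (v = w) - ?diff v\<bar>"
      using marg_bounds(1)[OF fin_U assms(3), of w] by (simp add: abs_mult)
    also have "\<bar>of_bool (v = w) - ?diff v\<bar> = of_bool (v = w) + \<bar>?diff v\<bar>"
      by (cases "v = w") (simp_all add: marg_outside)
    finally show ?thesis .
  qed
  then have "marg_dist t U (U - {w}) = ?p * ((\<Sum>v\<in>V. of_bool (v = w)) + total_influence t U w)"
    by (simp add: marg_dist_def total_influence_def sum.distrib flip: sum_distrib_left)
  also have "(\<Sum>v\<in>V. of_bool (v = w)) = (1 :: real)"
    using assms finite_V by (auto simp: of_bool_def)
  finally show ?thesis .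
qed

end

definition cavity_factor :: "real \<Rightarrow> real" where
  "cavity_factor a = (1 - a) * exp (a / (1 - a))"

lemma one_minus_le_cavity_factor:
  assumes "a < 1"
  shows "1 - y \<le> cavity_factor a * exp (- (y / (1 - a)))"
proof -
  have "1 - y = (1 - a) * (1 + (a - y) / (1 - a))"
    using assms by (simp add: field_simps)
  also have "\<dots> \<le> (1 - a) * exp ((a - y) / (1 - a))"
    using assms by (intro mult_left_mono exp_ge_add_one_self) auto
  finally show ?thesis
    by (simp add: cavity_factor_def diff_divide_distrib mult.assoc flip: exp_add)
qed

lemma cavity_factor_ge_1: "a < 1 \<Longrightarrow> 1 \<le> cavity_factor a"
  using one_minus_le_cavity_factor[of a 0] by simp

text \<open>The fugacity at which the infinite regular tree with \<open>d\<close> children per vertex has cavity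
  marginal \<open>a\<close>.\<close>

definition tree_fugacity :: "nat \<Rightarrow> real \<Rightarrow> real" where
  "tree_fugacity d a = a / (1 - a) ^ (d + 1)"

lemma tree_fugacity_pos: "0 < a \<Longrightarrow> a < 1 \<Longrightarrow> 0 < tree_fugacity d a"
  by (simp add: tree_fugacity_def)

lemma tree_fugacity_cavity_factor_power:
  assumes "a < 1"
  shows "tree_fugacity d a * cavity_factor a ^ d = a / (1 - a) * exp (real d * a / (1 - a))"
proof -
  have "exp (a / (1 - a)) ^ d = exp (real d * a / (1 - a))"
    by (simp flip: exp_of_nat_mult)
  then show ?thesis
    using assms by (simp add: tree_fugacity_def cavity_factor_def power_mult_distrib)
qed

lemma mult_one_minus_le_of_odds_le:
  fixes p a x :: real
  assumes "0 \<le> p" "a < 1" and odds: "p \<le> (1 - p) * (a / (1 - a) * exp (x / (1 - a)))"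
  shows "p * (1 - x) \<le> a"
proof -
  have "1 - (a + x) \<le> (1 - a) * exp (- x / (1 - a))"
    using one_minus_le_cavity_factor[OF assms(2), of "a + x"]
    by (simp add: cavity_factor_def add_divide_distrib mult.assoc flip: exp_add)
  then have "p * (1 - (a + x)) \<le> p * ((1 - a) * exp (- x / (1 - a)))"
    using assms(1) by (rule mult_left_mono)
  also have "\<dots> \<le> (1 - p) * (a / (1 - a) * exp (x / (1 - a))) * ((1 - a) * exp (- x / (1 - a)))"
    using odds assms(2) by (intro mult_right_mono) auto
  also have "\<dots> = (1 - p) * a"
    using assms(2) by (simp add: exp_minus field_simps)
  finally show ?thesis
    by (simp add: algebra_simps)
qed

context finite_simple_graph
begin

lemma Z_remove_le:
  assumes "finite U" "w \<in> U" "0 \<le> t" "a < 1" "y \<le> marg t U w"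
  shows "Z t (U - {w}) \<le> Z t U * (cavity_factor a * exp (- (y / (1 - a))))"
proof -
  have "Z t (U - {w}) = Z t U * (1 - marg t U w)"
    using one_minus_marg[OF assms(1-3)] Z_pos[OF assms(1,3)] by simp
  also have "\<dots> \<le> Z t U * (cavity_factor a * exp (- (y / (1 - a))))"
    using one_minus_le_cavity_factor[OF assms(4), of y] assms(5) Z_pos[OF assms(1,3)]
    by (intro mult_left_mono) auto
  finally show ?thesis .
qed

definition cavity_bounded :: "real \<Rightarrow> real \<Rightarrow> real \<Rightarrow> 'a set \<Rightarrow> 'a \<Rightarrow> bool" where
  "cavity_bounded t s a U w \<longleftrightarrow> s * marg_dist t U (U - {w}) \<le> min (marg t U w) a"

text \<open>By convexity of \<open>exp\<close>, the loss in \<open>Z\<close> can be expressed through the accumulated distance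
  alone, without reference to the single removals.\<close>

lemma marg_dist_remove_set:
  assumes "U \<subseteq> V" "N \<subseteq> U" "0 \<le> t" "a < 1" "0 \<le> s"
    and "\<And>W x. W \<subseteq> U \<Longrightarrow> x \<in> W \<Longrightarrow> x \<in> N \<Longrightarrow> cavity_bounded t s a W x"
  shows "s * marg_dist t U (U - N) \<le> real (card N) * a
    \<and> Z t (U - N) \<le> Z t U * (cavity_factor a ^ card N
      * exp (- (s * marg_dist t U (U - N) / (1 - a))))"
proof -
  let ?\<kappa> = "cavity_factor a"
  have factor_nonneg: "0 \<le> ?\<kappa>"
    using cavity_factor_ge_1[OF assms(4)] by linarith
  have fin_U: "finite U"
    using assms(1) finite_V by (rule finite_subset)
  then have "finite N"
    using assms(2) finite_subset by blast
  then show ?thesis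
    using assms(2,6)
  proof (induction N)
    case empty
    show ?case by (simp add: marg_dist_def)
  next
    case (insert x N)
    let ?W = "U - N"
    define A where "A = s * marg_dist t U ?W"
    define B where "B = s * marg_dist t ?W (?W - {x})"
    have IH: "A \<le> real (card N) * a" "Z t ?W \<le> Z t U * (?\<kappa> ^ card N * exp (- (A / (1 - a))))"
      unfolding A_def using insert.IH insert.prems by auto
    have remaining: "?W - {x} = U - insert x N" "x \<in> ?W" "finite ?W"
      using insert.hyps insert.prems(1) fin_U by auto
    have B_le: "B \<le> marg t ?W x" "B \<le> a"
      using insert.prems(2)[of ?W x] remaining(2) by (auto simp: B_def cavity_bounded_def)
    have triangle: "s * marg_dist t U (U - insert x N) \<le> A + B"
      unfolding A_def B_def remaining(1) distrib_left[symmetric]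
      by (intro mult_left_mono marg_dist_triangle assms)
    have "Z t (U - insert x N) \<le> Z t ?W * (?\<kappa> * exp (- (B / (1 - a))))"
      using Z_remove_le[OF remaining(3,2) assms(3,4) B_le(1)] by (simp add: remaining(1))
    also have "\<dots> \<le> Z t U * (?\<kappa> ^ card N * exp (- (A / (1 - a)))) * (?\<kappa> * exp (- (B / (1 - a))))"
      using IH(2) factor_nonneg by (intro mult_right_mono) auto
    also have "\<dots> = Z t U * (?\<kappa> ^ card (insert x N) * exp (- (A / (1 - a)) + - (B / (1 - a))))"
      unfolding exp_add using insert.hyps by (simp add: mult_ac)
    also have "\<dots> \<le> Z t U * (?\<kappa> ^ card (insert x N)
        * exp (- (s * marg_dist t U (U - insert x N) / (1 - a))))"
      using divide_right_mono[OF triangle, of "1 - a"] assms(4) Z_pos[OF fin_U assms(3)]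
        factor_nonneg
      by (intro mult_left_mono) (auto simp: add_divide_distrib)
    finally show ?case
      using triangle IH(1) B_le(2) insert.hyps by (simp add: distrib_right)
  qed
qed

lemma card_nbhd_Int_le:
  assumes "x \<in> nbhd w" "w \<notin> W" "card (nbhd x) \<le> d + 1"
  shows "card (nbhd x \<inter> W) \<le> d"
proof -
  have "nbhd x \<inter> W \<subset> nbhd x"
    using assms(1,2) nbhd_sym by blast
  from psubset_card_mono[OF finite_nbhd this] show ?thesis
    using assms(3) by simp
qed

context
  fixes d :: nat and a :: real
  assumes a_bounds: "0 < a" "real d * a < 1" "a < 1"
begin

abbreviation (input) critical_gap :: real where
  "critical_gap \<equiv> 1 - real d * a"

abbreviation (input) t\<^sub>a :: real where
  "t\<^sub>a \<equiv> tree_fugacity d a"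

lemma tree_influence_of_cavity:
  assumes "U \<subseteq> V"
    and cavity: "\<And>W x. W \<subseteq> U - {w} \<Longrightarrow> x \<in> W \<Longrightarrow> x \<in> nbhd w \<inter> U
      \<Longrightarrow> cavity_bounded t\<^sub>a critical_gap a W x"
  shows "critical_gap * total_influence t\<^sub>a U w \<le> real (card (nbhd w \<inter> U)) * a"
    and "Z t\<^sub>a (U - closed_nbhd w) \<le> Z t\<^sub>a (U - {w}) * (cavity_factor a ^ card (nbhd w \<inter> U)
      * exp (- (critical_gap * total_influence t\<^sub>a U w / (1 - a))))"
proof -
  have removed: "U - {w} - nbhd w \<inter> U = U - closed_nbhd w" by auto
  have "U - {w} \<subseteq> V" "nbhd w \<inter> U \<subseteq> U - {w}" "0 \<le> t\<^sub>a" "0 \<le> critical_gap"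
    using assms(1) not_self_nbhd a_bounds tree_fugacity_pos[of a d] by auto
  then show "critical_gap * total_influence t\<^sub>a U w \<le> real (card (nbhd w \<inter> U)) * a"
    "Z t\<^sub>a (U - closed_nbhd w) \<le> Z t\<^sub>a (U - {w}) * (cavity_factor a ^ card (nbhd w \<inter> U)
      * exp (- (critical_gap * total_influence t\<^sub>a U w / (1 - a))))"
    using marg_dist_remove_set[OF _ _ _ a_bounds(3) _ cavity, of "U - {w}" "nbhd w \<inter> U"]
    by (simp_all only: removed total_influence_def)
qed

lemma marg_le_odds:
  assumes "U \<subseteq> V" "w \<in> U" "card (nbhd w \<inter> U) \<le> d"
    and cavity: "\<And>W x. W \<subseteq> U - {w} \<Longrightarrow> x \<in> W \<Longrightarrow> x \<in> nbhd w \<inter> U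
      \<Longrightarrow> cavity_bounded t\<^sub>a critical_gap a W x"
  shows "marg t\<^sub>a U w \<le> (1 - marg t\<^sub>a U w)
    * (a / (1 - a) * exp ((real d * a - critical_gap * total_influence t\<^sub>a U w) / (1 - a)))"
proof -
  let ?p = "marg t\<^sub>a U w" and ?\<kappa> = "cavity_factor a"
    and ?e = "exp (- (critical_gap * total_influence t\<^sub>a U w / (1 - a)))"
  have fin_U: "finite U"
    using assms(1) finite_V by (rule finite_subset)
  have t_pos: "0 < t\<^sub>a"
    using a_bounds by (intro tree_fugacity_pos)
  have marg_less_1: "?p < 1"
    using marg_bounds(2)[OF fin_U] t_pos by simp
  have "?p = (1 - ?p) * (t\<^sub>a * (Z t\<^sub>a (U - closed_nbhd w) / Z t\<^sub>a (U - {w})))"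
    unfolding one_minus_marg[OF fin_U assms(2) less_imp_le[OF t_pos]]
    unfolding marg_eq[OF fin_U assms(2)]
    using Z_pos[of "U - {w}" t\<^sub>a] fin_U t_pos by simp
  also have "\<dots> \<le> (1 - ?p) * (t\<^sub>a * (?\<kappa> ^ card (nbhd w \<inter> U) * ?e))"
    using tree_influence_of_cavity(2)[of U w, OF assms(1) cavity] Z_pos[of "U - {w}" t\<^sub>a]
      fin_U marg_less_1 t_pos
    by (intro mult_left_mono) (auto simp: divide_le_eq mult.commute)
  also have "\<dots> \<le> (1 - ?p) * (t\<^sub>a * (?\<kappa> ^ d * ?e))"
    using cavity_factor_ge_1[OF a_bounds(3)] assms(3) marg_less_1 t_pos
    by (intro mult_left_mono mult_right_mono power_increasing) auto
  also have "t\<^sub>a * (?\<kappa> ^ d * ?e)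
      = a / (1 - a) * exp ((real d * a - critical_gap * total_influence t\<^sub>a U w) / (1 - a))"
    unfolding mult.assoc[symmetric] tree_fugacity_cavity_factor_power[OF a_bounds(3)]
    by (simp add: diff_divide_distrib flip: exp_add)
  finally show ?thesis .
qed

lemma cavity_bounded_tree:
  assumes degree: "\<And>v. card (nbhd v) \<le> d + 1"
    and "U \<subseteq> V" "w \<in> U" "card (nbhd w \<inter> U) \<le> d"
  shows "cavity_bounded t\<^sub>a critical_gap a U w"
  using assms(2-)
proof (induction "card U" arbitrary: U w rule: less_induct)
  case less
  let ?p = "marg t\<^sub>a U w" and ?I = "total_influence t\<^sub>a U w"
  have fin_U: "finite U"
    using less.prems(1) finite_V by (rule finite_subset)
  have t_pos: "0 < t\<^sub>a"
    using a_bounds by (intro tree_fugacity_pos)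
  have marg_nonneg: "0 \<le> ?p"
    using marg_bounds(1)[OF fin_U] t_pos by simp
  have cavity: "cavity_bounded t\<^sub>a critical_gap a W x"
    if "W \<subseteq> U - {w}" "x \<in> W" "x \<in> nbhd w \<inter> U" for W x
  proof (rule less.hyps)
    show "card W < card U"
      using that less.prems(2) fin_U by (intro psubset_card_mono) auto
    show "card (nbhd x \<inter> W) \<le> d"
      using that by (intro card_nbhd_Int_le[OF _ _ degree]) auto
  qed (use that less.prems in auto)
  have "?p * (1 - (real d * a - critical_gap * ?I)) \<le> a"
    using marg_nonneg a_bounds(3) marg_le_odds[OF less.prems cavity]
    by (rule mult_one_minus_le_of_odds_le)
  moreover have "critical_gap * ?I \<le> real d * a"
    using tree_influence_of_cavity(1)[of U w, OF less.prems(1) cavity] less.prems(3) a_bounds(1)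
      mult_right_mono[of "real (card (nbhd w \<inter> U))" "real d" a] by linarith
  then have "?p * (1 - (real d * a - critical_gap * ?I)) \<le> ?p"
    using marg_nonneg by (simp add: mult_left_le)
  moreover have "critical_gap * marg_dist t\<^sub>a U (U - {w})
    = ?p * (1 - (real d * a - critical_gap * ?I))"
    using less.prems t_pos by (simp add: marg_dist_remove algebra_simps)
  ultimately show ?case
    by (simp add: cavity_bounded_def)
qed

lemma total_influence_tree_le:
  assumes degree: "\<And>v. card (nbhd v) \<le> d + 1" and "U \<subseteq> V"
  shows "1 + total_influence t\<^sub>a U w \<le> (1 + a) / critical_gap"
proof -
  have "cavity_bounded t\<^sub>a critical_gap a W x"
    if "W \<subseteq> U - {w}" "x \<in> W" "x \<in> nbhd w \<inter> U" for W x
    using that assms(2) by (intro cavity_bounded_tree card_nbhd_Int_le[OF _ _ degree] degree) auto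
  then have "critical_gap * total_influence t\<^sub>a U w \<le> real (card (nbhd w \<inter> U)) * a"
    by (rule tree_influence_of_cavity(1)[of U w, OF assms(2)])
  also have "\<dots> \<le> real (d + 1) * a"
    using card_mono[OF finite_nbhd, of "nbhd w \<inter> U" w] degree[of w] a_bounds(1)
    by (intro mult_right_mono) auto
  finally show ?thesis
    using a_bounds by (simp add: field_simps)
qed

end

end

section \<open>Spectral independence\<close>

context finite_simple_graph
begin

text \<open>Covariances divided by marginals are the pairwise influences. A pinning of some vertices
  leaves the hardcore model on the set \<open>U\<close> of the remaining free ones, hence the quantification
  over \<open>U\<close>.\<close>

definition linf_independent :: "real \<Rightarrow> real \<Rightarrow> bool" where
  "linf_independent t \<eta> \<longleftrightarrow> (\<forall>U u. U \<subseteq> V \<longrightarrow> u \<in> U \<longrightarrow>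
     (\<Sum>v\<in>U. \<bar>gibbs_cov t U (occupied u) (occupied v)\<bar>) \<le> \<eta> * marg t U u)"

lemma linf_independent_card:
  assumes "0 \<le> t"
  shows "linf_independent t (real (card V))"
  unfolding linf_independent_def
proof (intro allI impI)
  fix U u assume pinning: "U \<subseteq> V" "u \<in> U"
  interpret finite_distribution "ind U" "hardcore U E t"
    using finite_subset[OF pinning(1) finite_V] assms by (rule finite_distribution_hardcore)
  have "(\<Sum>v\<in>U. \<bar>gibbs_cov t U (occupied u) (occupied v)\<bar>) \<le> (\<Sum>v\<in>U. marg t U u)"
    unfolding marg_def by (intro sum_mono abs_cov_le_mean) auto
  also have "\<dots> \<le> real (card V) * marg t U u"
    using card_mono[OF finite_V pinning(1)]
      marg_bounds(1)[OF finite_subset[OF pinning(1) finite_V] assms]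
    by (simp add: mult_right_mono)
  finally show "(\<Sum>v\<in>U. \<bar>gibbs_cov t U (occupied u) (occupied v)\<bar>) \<le> real (card V) * marg t U u" .
qed

lemma gibbs_cov_occupied:
  assumes "finite U" "u \<in> U" "0 \<le> t"
  shows "gibbs_cov t U (occupied u) (occupied v)
    = (1 - marg t U u) * (marg t U v - marg t (U - {u}) v)"
proof -
  have "gibbs_mean t U (\<lambda>S. occupied u S * occupied v S)
      = marg t U v - (1 - marg t U u) * marg t (U - {u}) v"
    using marg_split[OF assms, of v] unfolding gibbs_mean_occupied[OF assms]
    by (simp add: gibbs_mean_occupied_insert[OF assms(1,3)])
  then show ?thesis
    unfolding weighted_cov_def by (simp add: algebra_simps flip: marg_def)
qed

lemma linf_independent_of_total_influence:
  assumes "0 \<le> t" and influence: "\<And>U u. U \<subseteq> V \<Longrightarrow> u \<in> U \<Longrightarrow> 1 + total_influence t U u \<le> \<eta>"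
  shows "linf_independent t \<eta>"
  unfolding linf_independent_def
proof (intro allI impI)
  fix U u assume pinning: "U \<subseteq> V" "u \<in> U"
  have fin_U: "finite U"
    using pinning(1) finite_V by (rule finite_subset)
  have marg_range: "0 \<le> marg t U u" "marg t U u \<le> 1"
    using marg_bounds[OF fin_U assms(1), of u] by auto
  have "(\<Sum>v\<in>U. \<bar>gibbs_cov t U (occupied u) (occupied v)\<bar>)
      = (1 - marg t U u) * (\<Sum>v\<in>U. \<bar>marg t U v - marg t (U - {u}) v\<bar>)"
    using marg_range
    by (simp add: gibbs_cov_occupied[OF fin_U pinning(2) assms(1)] abs_mult sum_distrib_left)
  also have "\<dots> \<le> 1 * marg_dist t U (U - {u})"
    unfolding marg_dist_def using pinning(1) finite_V marg_range
    by (intro mult_mono sum_mono2) (auto intro: sum_nonneg)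
  also have "\<dots> \<le> \<eta> * marg t U u"
    using mult_left_mono[OF influence[OF pinning] marg_range(1)]
    by (simp add: marg_dist_remove[OF pinning assms(1)] mult.commute)
  finally show "(\<Sum>v\<in>U. \<bar>gibbs_cov t U (occupied u) (occupied v)\<bar>) \<le> \<eta> * marg t U u" .
qed

definition scaled_var :: "real \<Rightarrow> 'a set \<Rightarrow> ('a set \<Rightarrow> real) \<Rightarrow> real" where
  "scaled_var t U f = gibbs_sum t U (\<lambda>S. (f S)\<^sup>2) - (gibbs_sum t U f)\<^sup>2 / Z t U"

definition occupation_var :: "real \<Rightarrow> 'a set \<Rightarrow> ('a set \<Rightarrow> real) \<Rightarrow> real" where
  "occupation_var t U f = (\<Sum>v\<in>U. Z t (U - closed_nbhd v)
     * (gibbs_mean t (U - closed_nbhd v) (f \<circ> insert v) - gibbs_mean t U f)\<^sup>2)"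

lemma scaled_var_eq_cov:
  assumes "finite U" "0 \<le> t"
  shows "scaled_var t U f = Z t U * gibbs_cov t U f f"
  using Z_pos[OF assms]
  by (simp add: scaled_var_def weighted_cov_def gibbs_mean_eq power2_eq_square field_simps)

lemma occupation_var_le:
  assumes "linf_independent t \<eta>" "0 < \<eta>" "0 < t" "U \<subseteq> V"
  shows "t * occupation_var t U f \<le> \<eta> * scaled_var t U f"
proof -
  have fin_U: "finite U" and t_nonneg: "0 \<le> t"
    using finite_subset[OF assms(4) finite_V] assms(3) by auto
  have Z_pos_U: "0 < Z t U"
    using fin_U t_nonneg by (rule Z_pos)
  interpret finite_distribution "ind U" "hardcore U E t"
    using fin_U t_nonneg by (rule finite_distribution_hardcore)
  have summand: "t * (Z t (U - closed_nbhd v)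
        * (gibbs_mean t (U - closed_nbhd v) (f \<circ> insert v) - gibbs_mean t U f)\<^sup>2)
      = Z t U * ((gibbs_cov t U f (occupied v))\<^sup>2 / marg t U v)" if "v \<in> U" for v
  proof -
    have "gibbs_cov t U f (occupied v)
        = marg t U v * (gibbs_mean t (U - closed_nbhd v) (f \<circ> insert v) - gibbs_mean t U f)"
      unfolding weighted_cov_commute[of _ _ f] unfolding weighted_cov_def
      by (simp add: gibbs_mean_occupied[OF fin_U that t_nonneg] right_diff_distrib flip: marg_def)
    then have "(gibbs_cov t U f (occupied v))\<^sup>2 / marg t U v = marg t U v
        * (gibbs_mean t (U - closed_nbhd v) (f \<circ> insert v) - gibbs_mean t U f)\<^sup>2"
      by (simp add: power_mult_distrib power2_eq_square)
    then show ?thesis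
      using Z_pos_U by (simp add: marg_eq[OF fin_U that])
  qed
  have "t * occupation_var t U f = Z t U * (\<Sum>v\<in>U. (gibbs_cov t U f (occupied v))\<^sup>2 / marg t U v)"
    unfolding occupation_var_def sum_distrib_left by (rule sum.cong[OF refl summand])
  also have "\<dots> \<le> Z t U * (\<eta> * gibbs_cov t U f f)"
    unfolding marg_def
  proof (intro mult_left_mono sum_cov_squares_le assms(2))
    show "0 < gibbs_mean t U (occupied v)" if "v \<in> U" for v
      using marg_pos[OF fin_U that assms(3)] by (simp add: marg_def)
    show "(\<Sum>v\<in>U. \<bar>gibbs_cov t U (occupied u) (occupied v)\<bar>) \<le> \<eta> * gibbs_mean t U (occupied u)"
      if "u \<in> U" for u
      using assms(1,4) that by (simp add: linf_independent_def flip: marg_def)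
  qed (use Z_pos_U in simp)
  finally show ?thesis
    by (simp add: scaled_var_eq_cov[OF fin_U t_nonneg] mult_ac)
qed

section \<open>Conditional variance along the fugacity\<close>

lemma sum_card_ind:
  fixes h :: "nat \<Rightarrow> 'a set \<Rightarrow> real"
  assumes "finite U"
  shows "(\<Sum>S\<in>ind U. real (card S) * h (card S - 1) S)
    = (\<Sum>v\<in>U. \<Sum>S\<in>ind (U - closed_nbhd v). h (card S) (insert v S))"
proof -
  have "(\<Sum>S\<in>ind U. real (card S) * h (card S - 1) S)
      = (\<Sum>S\<in>ind U. \<Sum>v | v \<in> U \<and> v \<in> S. h (card S - 1) S)"
  proof (rule sum.cong[OF refl])
    fix S assume "S \<in> ind U"
    then have "{v. v \<in> U \<and> v \<in> S} = S" by (auto simp: ind_iff)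
    then show "real (card S) * h (card S - 1) S = (\<Sum>v | v \<in> U \<and> v \<in> S. h (card S - 1) S)"
      by simp
  qed
  also have "\<dots> = (\<Sum>v\<in>U. \<Sum>S | S \<in> ind U \<and> v \<in> S. h (card S - 1) S)"
    by (rule sum.swap_restrict) (use assms finite_ind in auto)
  also have "\<dots> = (\<Sum>v\<in>U. \<Sum>S\<in>ind (U - closed_nbhd v). h (card S) (insert v S))"
    by (rule sum.cong[OF refl], subst sum_ind_containing) (simp_all add: card_insert_ind[OF assms])
  finally show ?thesis .
qed

lemma gibbs_sum_has_derivative:
  assumes "finite U"
  shows "((\<lambda>t. gibbs_sum t U f) has_real_derivative
    (\<Sum>v\<in>U. gibbs_sum t (U - closed_nbhd v) (f \<circ> insert v))) (at t)"
proof -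
  have "((\<lambda>t. gibbs_sum t U f) has_real_derivative
      (\<Sum>S\<in>ind U. real (card S) * (t ^ (card S - 1) * f S))) (at t)"
    unfolding gibbs_sum_def by (auto intro!: derivative_eq_intros sum.cong)
  then show ?thesis
    using sum_card_ind[OF assms, of "\<lambda>k S. t ^ k * f S"] by (simp add: gibbs_sum_def)
qed

lemma scaled_var_has_derivative:
  assumes "finite U" "0 \<le> t"
  shows "((\<lambda>t. scaled_var t U f) has_real_derivative
    occupation_var t U f + (\<Sum>v\<in>U. scaled_var t (U - closed_nbhd v) (f \<circ> insert v))) (at t)"
proof -
  let ?A = "gibbs_sum t U f" and ?Z = "Z t U"
  let ?Av = "\<lambda>v. gibbs_sum t (U - closed_nbhd v) (f \<circ> insert v)"
    and ?Bv = "\<lambda>v. gibbs_sum t (U - closed_nbhd v) ((\<lambda>S. (f S)\<^sup>2) \<circ> insert v)"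
    and ?Zv = "\<lambda>v. Z t (U - closed_nbhd v)"
  have Z_nonzero: "?Z \<noteq> 0" "?Zv v \<noteq> 0" for v
    using Z_pos[of U t] Z_pos[of "U - closed_nbhd v" t] assms by auto
  have Z_deriv: "((\<lambda>t. Z t U) has_real_derivative (\<Sum>v\<in>U. ?Zv v)) (at t)"
    using gibbs_sum_has_derivative[OF assms(1), of "\<lambda>_. 1"] by (simp add: gibbs_sum_one comp_def)
  have "((\<lambda>t. scaled_var t U f) has_real_derivative (\<Sum>v\<in>U. ?Bv v)
      - (2 * ?A * (\<Sum>v\<in>U. ?Av v) * ?Z - ?A\<^sup>2 * (\<Sum>v\<in>U. ?Zv v)) / (?Z * ?Z)) (at t)"
    unfolding scaled_var_def
    by (rule derivative_eq_intros gibbs_sum_has_derivative[OF assms(1)] Z_deriv refl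
      | use Z_nonzero(1) in simp)+
  also have "(\<Sum>v\<in>U. ?Bv v) - (2 * ?A * (\<Sum>v\<in>U. ?Av v) * ?Z - ?A\<^sup>2 * (\<Sum>v\<in>U. ?Zv v)) / (?Z * ?Z)
      = (\<Sum>v\<in>U. ?Bv v - (2 * ?A * ?Av v * ?Z - ?A\<^sup>2 * ?Zv v) / (?Z * ?Z))"
    by (simp add: sum_subtractf sum_distrib_left sum_distrib_right
      sum_divide_distrib diff_divide_distrib)
  also have "\<dots> = (\<Sum>v\<in>U. ?Zv v * (?Av v / ?Zv v - ?A / ?Z)\<^sup>2 + (?Bv v - (?Av v)\<^sup>2 / ?Zv v))"
    using Z_nonzero by (intro sum.cong refl) (simp add: field_simps power2_eq_square)
  also have "\<dots> = occupation_var t U f + (\<Sum>v\<in>U. scaled_var t (U - closed_nbhd v) (f \<circ> insert v))"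
    by (simp add: occupation_var_def scaled_var_def gibbs_mean_eq sum.distrib comp_def)
  finally show ?thesis .
qed

definition free :: "'a set \<Rightarrow> 'a set" where
  "free R = V - (\<Union>x\<in>R. closed_nbhd x)"

lemma free_subset: "free R \<subseteq> V"
  by (auto simp: free_def)

lemma finite_free: "finite (free R)"
  using free_subset finite_V by (rule finite_subset)

lemma free_insert: "free (insert v R) = free R - closed_nbhd v"
  by (auto simp: free_def)

lemma ind_free:
  assumes "v \<in> V"
  shows "{R \<in> ind V. v \<in> free R} = ind (V - closed_nbhd v)"
  by (rule set_eqI, unfold mem_Collect_eq ind_iff free_def) (use assms nbhd_sym in blast)

lemma sum_ind_free_swap:
  fixes h :: "'a \<Rightarrow> 'a set \<Rightarrow> real"
  shows "(\<Sum>R\<in>ind V. \<Sum>v\<in>free R. h v R) = (\<Sum>v\<in>V. \<Sum>R\<in>ind (V - closed_nbhd v). h v R)"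
proof -
  have "(\<Sum>R\<in>ind V. \<Sum>v\<in>free R. h v R) = (\<Sum>R\<in>ind V. \<Sum>v | v \<in> V \<and> v \<in> free R. h v R)"
    by (intro sum.cong refl) (use free_subset in auto)
  also have "\<dots> = (\<Sum>v\<in>V. \<Sum>R | R \<in> ind V \<and> v \<in> free R. h v R)"
    by (rule sum.swap_restrict) (use finite_V finite_ind in auto)
  also have "\<dots> = (\<Sum>v\<in>V. \<Sum>R\<in>ind (V - closed_nbhd v). h v R)"
    by (intro sum.cong refl) (simp add: ind_free)
  finally show ?thesis .
qed

lemma comp_Un_insert: "f \<circ> (\<union>) R \<circ> insert v = f \<circ> (\<union>) (insert v R)"
  by (simp add: fun_eq_iff)

text \<open>Up to the factor \<open>Z lam V\<close>: if \<open>R\<close> keeps every vertex of a hardcore sample at fugacity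
  \<open>lam\<close> independently with probability \<open>1 - t / lam\<close>, then the rest of the sample is hardcore
  on \<open>free R\<close> at fugacity \<open>t\<close>, and this is the expected conditional variance given \<open>R\<close>.\<close>

definition residual_var :: "real \<Rightarrow> ('a set \<Rightarrow> real) \<Rightarrow> real \<Rightarrow> real" where
  "residual_var lam f t = (\<Sum>R\<in>ind V. (lam - t) ^ card R * scaled_var t (free R) (f \<circ> (\<union>) R))"

definition residual_var_deriv :: "real \<Rightarrow> ('a set \<Rightarrow> real) \<Rightarrow> real \<Rightarrow> real" where
  "residual_var_deriv lam f t
     = (\<Sum>R\<in>ind V. (lam - t) ^ card R * occupation_var t (free R) (f \<circ> (\<union>) R))"

definition flip_energy :: "real \<Rightarrow> ('a set \<Rightarrow> real) \<Rightarrow> real" where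
  "flip_energy lam f = (\<Sum>R\<in>ind V. lam ^ card R * (\<Sum>v\<in>free R. (f (insert v R) - f R)\<^sup>2))"

lemma residual_var_has_derivative:
  assumes "0 \<le> t"
  shows "(residual_var lam f has_real_derivative residual_var_deriv lam f t) (at t)"
proof -
  let ?W = "\<lambda>R. scaled_var t (free R) (f \<circ> (\<union>) R)"
    and ?O = "\<lambda>R. occupation_var t (free R) (f \<circ> (\<union>) R)"
  have scaled_var_deriv: "((\<lambda>t. scaled_var t (free R) (f \<circ> (\<union>) R)) has_real_derivative
      ?O R + (\<Sum>v\<in>free R. ?W (insert v R))) (at t)" for R
    using scaled_var_has_derivative[OF finite_free assms, of R "f \<circ> (\<union>) R"]
    by (simp only: free_insert[symmetric] comp_Un_insert)
  have "(residual_var lam f has_real_derivative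
      (\<Sum>R\<in>ind V. (lam - t) ^ card R * (?O R + (\<Sum>v\<in>free R. ?W (insert v R)))
        - real (card R) * ((lam - t) ^ (card R - 1) * ?W R))) (at t)"
    unfolding residual_var_def[abs_def]
    by (rule derivative_eq_intros scaled_var_deriv refl | simp add: algebra_simps)+
  moreover have "(\<Sum>R\<in>ind V. \<Sum>v\<in>free R. (lam - t) ^ card R * ?W (insert v R))
      = (\<Sum>R\<in>ind V. real (card R) * ((lam - t) ^ (card R - 1) * ?W R))"
    unfolding sum_ind_free_swap
    by (rule sum_card_ind[OF finite_V, of "\<lambda>k R. (lam - t) ^ k * ?W R", symmetric])
  ultimately show ?thesis
    by (simp add: residual_var_deriv_def sum_subtractf distrib_left sum.distrib sum_distrib_left)
qed

lemma residual_var_0: "residual_var lam f 0 = 0"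
  using gibbs_sum_0[OF finite_free, of _ "\<lambda>_. 1"]
  by (simp add: residual_var_def scaled_var_def gibbs_sum_0[OF finite_free] gibbs_sum_one)

lemma residual_var_deriv_0: "residual_var_deriv lam f 0 = flip_energy lam f"
proof -
  have "Z 0 (free R) = 1" for R
    using gibbs_sum_0[OF finite_free, of R "\<lambda>_. 1"] by (simp add: gibbs_sum_one)
  then show ?thesis
    by (simp add: residual_var_deriv_def occupation_var_def flip_energy_def gibbs_mean_eq
        gibbs_sum_0[OF finite_free] flip: free_insert)
qed

lemma residual_var_full: "residual_var lam f lam = scaled_var lam V f"
proof -
  have "residual_var lam f lam
    = (\<Sum>R\<in>{{}}. (lam - lam) ^ card R * scaled_var lam (free R) (f \<circ> (\<union>) R))"
    unfolding residual_var_def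
    by (rule sum.mono_neutral_right)
      (use finite_V finite_ind empty_in_ind finite_mem_ind in \<open>auto simp: card_gt_0_iff\<close>)
  then show ?thesis
    by (simp add: free_def comp_def)
qed

lemma residual_var_deriv_le:
  assumes "linf_independent t \<eta>" "0 < \<eta>" "0 < t" "t \<le> lam"
  shows "t * residual_var_deriv lam f t \<le> \<eta> * residual_var lam f t"
proof -
  have "(\<Sum>R\<in>ind V. (lam - t) ^ card R * (t * occupation_var t (free R) (f \<circ> (\<union>) R)))
      \<le> (\<Sum>R\<in>ind V. (lam - t) ^ card R * (\<eta> * scaled_var t (free R) (f \<circ> (\<union>) R)))"
    using assms(4) by (intro sum_mono mult_left_mono occupation_var_le assms free_subset) auto
  then show ?thesis
    by (simp add: residual_var_def residual_var_deriv_def sum_distrib_left mult.left_commute)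
qed

lemma residual_var_power_le:
  assumes "0 < s" "s \<le> lam" "V \<noteq> {}"
  shows "residual_var lam f lam \<le> (lam / s) ^ card V * residual_var lam f s"
proof -
  let ?n = "real (card V)"
  have n_pos: "0 < ?n"
    using assms(3) finite_V by (simp add: card_gt_0_iff)
  have "residual_var lam f lam \<le> exp (?n * ln lam - ?n * ln s) * residual_var lam f s"
  proof (rule gronwall[where G = "\<lambda>t. ?n * ln t" and G' = "\<lambda>t. ?n * (1 / t)"
        and W' = "residual_var_deriv lam f", OF assms(2)])
    fix t assume t_range: "s \<le> t" "t \<le> lam"
    show "(residual_var lam f has_real_derivative residual_var_deriv lam f t) (at t)"
      using t_range assms(1) by (intro residual_var_has_derivative) auto
    show "((\<lambda>t. ?n * ln t) has_real_derivative ?n * (1 / t)) (at t)"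
      using t_range assms(1) by (intro DERIV_cmult DERIV_ln_divide) auto
    have "t * residual_var_deriv lam f t \<le> ?n * residual_var lam f t"
      using t_range assms(1) by (intro residual_var_deriv_le linf_independent_card n_pos) auto
    then show "residual_var_deriv lam f t \<le> ?n * (1 / t) * residual_var lam f t"
      using t_range assms(1) by (simp add: field_simps)
  qed
  also have "exp (?n * ln lam - ?n * ln s) = exp (?n * ln (lam / s))"
    using assms(1,2) by (simp add: ln_div right_diff_distrib)
  also have "\<dots> = (lam / s) ^ card V"
    using assms(1,2) by (simp add: exp_of_nat_mult)
  finally show ?thesis .
qed

end

section \<open>Poincare inequality at the critical fugacity\<close>

lemma tree_fugacity_has_derivative:
  assumes "a < 1"
  shows "(tree_fugacity d has_real_derivative (1 + real d * a) / (1 - a) ^ (d + 2)) (at a)"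
proof -
  have "((\<lambda>a. a / (1 - a) ^ (d + 1)) has_real_derivative
      (1 * (1 - a) ^ (d + 1) - a * (real (d + 1) * (1 - a) ^ d * (- 1)))
        / ((1 - a) ^ (d + 1) * (1 - a) ^ (d + 1))) (at a)"
    by (rule derivative_eq_intros refl | use assms in simp)+
  moreover have "(1 * (1 - a) ^ (d + 1) - a * (real (d + 1) * (1 - a) ^ d * (- 1)))
        / ((1 - a) ^ (d + 1) * (1 - a) ^ (d + 1)) = (1 + real d * a) / (1 - a) ^ (d + 2)"
    using assms by (simp add: divide_simps) (simp add: algebra_simps)
  ultimately show ?thesis by (simp add: tree_fugacity_def[abs_def])
qed

lemma tree_fugacity_mono:
  assumes "0 \<le> a" "a \<le> b" "b < 1"
  shows "tree_fugacity d a \<le> tree_fugacity d b"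
  unfolding tree_fugacity_def using assms by (intro frac_le power_mono) auto

definition tree_exponent :: "nat \<Rightarrow> real" where
  "tree_exponent d = 2 * (real d + 1) / (real d - 1)"

text \<open>In the parameter \<open>a\<close>, the tree bound on the total influence integrates in closed form.\<close>

lemma tree_influence_log_derivative:
  assumes "2 \<le> d" "0 < a" "a < 1" "real d * a < 1"
  shows "1 / a + tree_exponent d * (real d / (1 - real d * a) - 1 / (1 - a))
    = (1 + a) / (1 - real d * a) * ((1 + real d * a) / (a * (1 - a)))"
proof -
  have "real d / (1 - real d * a) - 1 / (1 - a) = (real d - 1) / ((1 - a) * (1 - real d * a))"
    using assms by (simp add: field_simps)
  then have "1 / a + tree_exponent d * (real d / (1 - real d * a) - 1 / (1 - a))
      = 1 / a + 2 * (real d + 1) / ((1 - a) * (1 - real d * a))"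
    using assms(1) by (simp add: tree_exponent_def)
  also have "\<dots> = ((1 - a) * (1 - real d * a) + 2 * (real d + 1) * a)
    / (a * ((1 - a) * (1 - real d * a)))"
    using assms by (subst add_frac_eq) auto
  also have "(1 - a) * (1 - real d * a) + 2 * (real d + 1) * a = (1 + a) * (1 + real d * a)"
    by (simp add: algebra_simps)
  finally show ?thesis by (simp add: mult_ac)
qed

lemma (in finite_simple_graph) residual_var_tree_deriv_le:
  assumes "2 \<le> d" and degree: "\<And>v. card (nbhd v) \<le> d + 1"
    and a_bounds: "0 < a" "a < 1" "real d * a < 1" and t_le_lam: "tree_fugacity d a \<le> lam"
  shows "residual_var_deriv lam f (tree_fugacity d a) * ((1 + real d * a) / (1 - a) ^ (d + 2))
    \<le> (1 / a + tree_exponent d * (real d / (1 - real d * a) - 1 / (1 - a)))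
      * residual_var lam f (tree_fugacity d a)"
proof -
  let ?t = "tree_fugacity d a" and ?\<eta> = "(1 + a) / (1 - real d * a)"
    and ?g = "(1 + real d * a) / (a * (1 - a))"
  have t_pos: "0 < ?t"
    using a_bounds by (intro tree_fugacity_pos)
  then have "linf_independent ?t ?\<eta>"
    by (intro linf_independent_of_total_influence total_influence_tree_le a_bounds degree) auto
  then have "?t * residual_var_deriv lam f ?t \<le> ?\<eta> * residual_var lam f ?t"
    using a_bounds t_pos t_le_lam by (intro residual_var_deriv_le) auto
  then have "?t * residual_var_deriv lam f ?t * ?g \<le> ?\<eta> * residual_var lam f ?t * ?g"
    using a_bounds by (intro mult_right_mono) auto
  moreover have "residual_var_deriv lam f ?t * ((1 + real d * a) / (1 - a) ^ (d + 2))
      = ?t * residual_var_deriv lam f ?t * ?g"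
    using a_bounds by (simp add: tree_fugacity_def)
  ultimately show ?thesis
    unfolding tree_influence_log_derivative[OF assms(1) a_bounds] by (simp only: mult_ac)
qed

lemma (in finite_simple_graph) residual_var_tree_le:
  assumes "2 \<le> d" and degree: "\<And>v. card (nbhd v) \<le> d + 1"
    and b_bounds: "0 < b" "real d * b < 1" and t_le_lam: "tree_fugacity d b \<le> lam"
  shows "residual_var lam f (tree_fugacity d b)
    \<le> b * ((1 - b) / (1 - real d * b)) powr tree_exponent d * flip_energy lam f"
proof -
  define U where "U a = residual_var lam f (tree_fugacity d a)" for a
  define H where "H a = tree_exponent d * (ln (1 - a) - ln (1 - real d * a))" for a
  have below_1: "a < 1" "real d * a < 1" if "0 \<le> a" "a \<le> b" for a
  proof -
    have "1 * a \<le> real d * a" "real d * a \<le> real d * b"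
      using that assms(1) by (intro mult_right_mono mult_left_mono; simp)+
    then show "a < 1" "real d * a < 1" using b_bounds by auto
  qed
  have U_deriv: "(U has_real_derivative residual_var_deriv lam f (tree_fugacity d a)
      * ((1 + real d * a) / (1 - a) ^ (d + 2))) (at a)" if "0 \<le> a" "a \<le> b" for a
    unfolding U_def[abs_def]
    by (intro DERIV_chain2[OF residual_var_has_derivative tree_fugacity_has_derivative])
      (use below_1[OF that] that in \<open>auto simp: tree_fugacity_def\<close>)
  have H_deriv: "(H has_real_derivative
      tree_exponent d * (real d / (1 - real d * a) - 1 / (1 - a))) (at a)"
    if "0 \<le> a" "a \<le> b" for a
    unfolding H_def[abs_def] by (rule derivative_eq_intros refl | use below_1[OF that] in simp)+
  have "U b \<le> b * exp (H b - H 0) * flip_energy lam f"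
  proof (rule gronwall_from_zero[OF b_bounds(1)])
    show "U 0 = 0" "isCont H 0"
      using DERIV_isCont[OF H_deriv[of 0]] b_bounds(1)
      by (simp_all add: U_def tree_fugacity_def residual_var_0)
    show "(U has_real_derivative flip_energy lam f) (at 0)"
      using U_deriv[of 0] b_bounds(1) by (simp add: tree_fugacity_def residual_var_deriv_0)
    fix a assume a_range: "0 < a" "a \<le> b"
    have "tree_fugacity d a \<le> lam"
      using tree_fugacity_mono[of a b d] a_range below_1(1)[of b] b_bounds(1) t_le_lam by linarith
    then show "residual_var_deriv lam f (tree_fugacity d a) * ((1 + real d * a) / (1 - a) ^ (d + 2))
        \<le> (1 / a + tree_exponent d * (real d / (1 - real d * a) - 1 / (1 - a))) * U a"
      unfolding U_def
      using a_range below_1[of a] by (intro residual_var_tree_deriv_le assms(1) degree) auto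
  qed (use U_deriv H_deriv in auto)
  also have "exp (H b - H 0) = ((1 - b) / (1 - real d * b)) powr tree_exponent d"
    using below_1[of b] b_bounds by (simp add: H_def powr_def ln_div)
  finally show ?thesis
    by (simp add: U_def)
qed

lemma lambda_c_eq_tree_fugacity:
  assumes "2 \<le> d"
  shows "lambda_c (Suc d) = tree_fugacity d (1 / real d)"
proof -
  have "1 - 1 / real d = (real d - 1) / real d"
    using assms by (simp add: field_simps)
  then show ?thesis
    using assms by (simp add: lambda_c_def tree_fugacity_def power_divide)
qed

lemma lambda_c_ge:
  assumes "2 \<le> d"
  shows "1 / (real d - 1) \<le> lambda_c (Suc d)"
proof -
  have "(1 - 1 / real d) ^ (d + 1) \<le> (1 - 1 / real d) ^ 1"
    using assms by (intro power_decreasing) auto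
  then have "(1 / real d) / (1 - 1 / real d) \<le> lambda_c (Suc d)"
    unfolding lambda_c_eq_tree_fugacity[OF assms] tree_fugacity_def
    using assms by (intro divide_left_mono) auto
  then show ?thesis
    using assms by (simp add: field_simps)
qed

lemma lambda_c_pos:
  assumes "2 \<le> d"
  shows "0 < lambda_c (Suc d)"
  unfolding lambda_c_eq_tree_fugacity[OF assms] using assms by (intro tree_fugacity_pos) auto

lemma lambda_c_occupancy_ge:
  assumes "2 \<le> d"
  shows "1 / real d \<le> lambda_c (Suc d) / (1 + lambda_c (Suc d))"
  using lambda_c_ge[OF assms] lambda_c_pos[OF assms] assms by (simp add: field_simps)

lemma lambda_c_le:
  assumes "2 \<le> d"
  shows "lambda_c (Suc d) \<le> exp 2"
proof -
  have "lambda_c (Suc d) = (1 / (real d - 1)) * (real d / (real d - 1)) ^ d"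
    by (simp add: lambda_c_def power_divide)
  also have "\<dots> \<le> 1 * exp (1 / (real d - 1)) ^ d"
  proof (intro mult_mono power_mono)
    have "real d / (real d - 1) = 1 + 1 / (real d - 1)"
      using assms by (simp add: field_simps)
    then show "real d / (real d - 1) \<le> exp (1 / (real d - 1))"
      using exp_ge_add_one_self by metis
  qed (use assms in auto)
  also have "\<dots> = exp (real d / (real d - 1))"
    by (simp flip: exp_of_nat_mult)
  also have "\<dots> \<le> exp 2"
    using assms by (simp add: field_simps)
  finally show ?thesis .
qed

text \<open>The cavity marginal at which \<open>1 - d a = 1 / n\<close>.\<close>

definition near_critical :: "nat \<Rightarrow> nat \<Rightarrow> real" where
  "near_critical d n = (1 - 1 / real n) / real d"

lemma near_critical_bounds:
  assumes "2 \<le> d" "2 \<le> n"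
  shows "0 < near_critical d n" "near_critical d n \<le> 1 / real d" "near_critical d n < 1"
proof -
  show "0 < near_critical d n" and critical: "near_critical d n \<le> 1 / real d"
    using assms by (auto simp: near_critical_def divide_right_mono)
  have "1 / real d < 1"
    using assms by simp
  with critical show "near_critical d n < 1" by linarith
qed

lemma lambda_c_ratio_power_le:
  assumes "2 \<le> d" "2 \<le> n"
  shows "(lambda_c (Suc d) / tree_fugacity d (near_critical d n)) ^ n \<le> exp 5"
proof -
  let ?b = "near_critical d n"
  note b_bounds = near_critical_bounds[OF assms]
  have "lambda_c (Suc d) / tree_fugacity d ?b
      = 1 / (1 - 1 / real n) * ((1 - ?b) / (1 - 1 / real d)) ^ (d + 1)"
    using assms b_bounds
    by (simp add: lambda_c_eq_tree_fugacity tree_fugacity_def power_divide)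
      (simp add: near_critical_def)
  also have "\<dots> \<le> exp (1 / (real n - 1)) * exp (1 / (real n * (real d - 1))) ^ (d + 1)"
  proof (intro mult_mono power_mono)
    have "1 / (1 - 1 / real n) = 1 + 1 / (real n - 1)"
      using assms by (simp add: field_simps)
    then show "1 / (1 - 1 / real n) \<le> exp (1 / (real n - 1))"
      using exp_ge_add_one_self by metis
    have "(1 - ?b) / (1 - 1 / real d) = 1 + 1 / (real n * (real d - 1))"
      using assms by (simp add: near_critical_def field_simps)
    then show "(1 - ?b) / (1 - 1 / real d) \<le> exp (1 / (real n * (real d - 1)))"
      using exp_ge_add_one_self by metis
  qed (use b_bounds assms in auto)
  also have "\<dots> = exp (1 / (real n - 1) + (real d + 1) / (real n * (real d - 1)))"
    by (simp only: exp_of_nat_mult[symmetric] exp_add[symmetric]) (simp add: add.commute)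
  finally have "(lambda_c (Suc d) / tree_fugacity d ?b) ^ n
      \<le> exp (1 / (real n - 1) + (real d + 1) / (real n * (real d - 1))) ^ n"
    using lambda_c_pos[OF assms(1)] tree_fugacity_pos[OF b_bounds(1,3), of d]
    by (intro power_mono) auto
  also have "\<dots> = exp (real n / (real n - 1) + (real d + 1) / (real d - 1))"
    using assms by (simp add: distrib_left[of _ "1 / _"] flip: exp_of_nat_mult)
  also have "\<dots> \<le> exp (2 + 3)"
    using assms by (intro exp_le_cancel_iff[THEN iffD2] add_mono) (auto simp: field_simps)
  finally show ?thesis by simp
qed

context finite_simple_graph
begin

lemma flip_energy_nonneg: "0 \<le> lam \<Longrightarrow> 0 \<le> flip_energy lam f"
  unfolding flip_energy_def by (intro sum_nonneg mult_nonneg_nonneg) auto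

lemma residual_var_near_critical_le:
  assumes d_ge_2: "2 \<le> d" and degree: "\<And>v. card (nbhd v) \<le> d + 1" and n_ge_2: "2 \<le> n"
    and t_le_lam: "tree_fugacity d (near_critical d n) \<le> lam"
  shows "residual_var lam f (tree_fugacity d (near_critical d n))
    \<le> 1 / real d * real n powr tree_exponent d * flip_energy lam f"
proof -
  let ?b = "near_critical d n"
  note b_bounds = near_critical_bounds[OF d_ge_2 n_ge_2]
  have gap_eq: "1 - real d * ?b = 1 / real n" "real d * ?b < 1"
    using d_ge_2 n_ge_2 by (auto simp: near_critical_def)
  have "0 \<le> lam"
    using t_le_lam tree_fugacity_pos[OF b_bounds(1,3), of d] by linarith
  have "residual_var lam f (tree_fugacity d ?b)
      \<le> ?b * ((1 - ?b) / (1 - real d * ?b)) powr tree_exponent d * flip_energy lam f"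
    by (rule residual_var_tree_le[OF d_ge_2 degree b_bounds(1) gap_eq(2) t_le_lam])
  also have "\<dots> \<le> 1 / real d * real n powr tree_exponent d * flip_energy lam f"
  proof (intro mult_right_mono mult_mono flip_energy_nonneg \<open>0 \<le> lam\<close> b_bounds(2))
    show "((1 - ?b) / (1 - real d * ?b)) powr tree_exponent d \<le> real n powr tree_exponent d"
      using b_bounds n_ge_2 d_ge_2 unfolding gap_eq(1)
      by (intro powr_mono2) (auto simp: tree_exponent_def mult_left_le_one_le)
  qed auto
  finally show ?thesis .
qed

lemma poincare_critical:
  assumes d_ge_2: "2 \<le> d" and degree: "\<And>v. card (nbhd v) \<le> d + 1" and n_ge_2: "2 \<le> card V"
  defines "lam \<equiv> lambda_c (Suc d)"
  shows "scaled_var lam V f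
    \<le> exp 5 * real (card V) powr tree_exponent d * (lam / (1 + lam) * flip_energy lam f)"
proof -
  define s where "s = tree_fugacity d (near_critical d (card V))"
  note b_bounds = near_critical_bounds[OF d_ge_2 n_ge_2]
  have lam_pos: "0 < lam"
    unfolding lam_def using d_ge_2 by (rule lambda_c_pos)
  have s_bounds: "0 < s" "s \<le> lam"
    using tree_fugacity_pos[OF b_bounds(1,3)]
      tree_fugacity_mono[of "near_critical d (card V)" "1 / real d" d] b_bounds d_ge_2
    by (auto simp: s_def lam_def lambda_c_eq_tree_fugacity)
  have "V \<noteq> {}"
    using n_ge_2 by auto
  then have "scaled_var lam V f \<le> (lam / s) ^ card V * residual_var lam f s"
    using residual_var_power_le[OF s_bounds] by (simp add: residual_var_full)
  also have "\<dots> \<le> (lam / s) ^ card V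
      * (1 / real d * real (card V) powr tree_exponent d * flip_energy lam f)"
    using residual_var_near_critical_le[OF d_ge_2 degree n_ge_2
      s_bounds(2)[unfolded s_def], of f] s_bounds
    by (intro mult_left_mono) (auto simp: s_def)
  also have "\<dots> \<le> exp 5 * (lam / (1 + lam) * real (card V) powr tree_exponent d * flip_energy lam f)"
  proof (intro mult_mono mult_right_mono flip_energy_nonneg)
    show "(lam / s) ^ card V \<le> exp 5"
      unfolding lam_def s_def by (rule lambda_c_ratio_power_le[OF d_ge_2 n_ge_2])
    show "1 / real d \<le> lam / (1 + lam)"
      unfolding lam_def by (rule lambda_c_occupancy_ge[OF d_ge_2])
  qed (use lam_pos flip_energy_nonneg in auto)
  finally show ?thesis
    by (simp add: mult_ac)
qed

end

section \<open>Glauber dynamics\<close>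

context finite_simple_graph
begin

definition heat_bath :: "real \<Rightarrow> 'a \<Rightarrow> ('a set \<Rightarrow> real) \<Rightarrow> 'a set \<Rightarrow> real" where
  "heat_bath lam v f \<sigma> = (if insert v \<sigma> \<in> ind V
     then (f (\<sigma> - {v}) + lam * f (insert v \<sigma>)) / (1 + lam) else f (\<sigma> - {v}))"

lemma gibbs_sum_pairs:
  assumes "v \<in> V"
  shows "gibbs_sum lam V g
    = (\<Sum>R\<in>ind (V - closed_nbhd v). lam ^ card R * (g R + lam * g (insert v R)))
      + (\<Sum>R\<in>ind (V - {v}) - ind (V - closed_nbhd v). lam ^ card R * g R)"
proof -
  have "ind (V - closed_nbhd v) \<subseteq> ind (V - {v})"
    by (auto simp: ind_iff)
  then have "gibbs_sum lam (V - {v}) g = gibbs_sum lam (V - closed_nbhd v) g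
      + (\<Sum>R\<in>ind (V - {v}) - ind (V - closed_nbhd v). lam ^ card R * g R)"
    unfolding gibbs_sum_def using finite_ind[of "V - {v}"] finite_V
    by (simp add: sum.subset_diff[of "ind (V - closed_nbhd v)"])
  then show ?thesis
    using gibbs_sum_split[OF finite_V assms, of lam g]
    by (simp add: gibbs_sum_def sum_distrib_left distrib_left sum.distrib mult.left_commute)
qed

lemma heat_bath_free:
  assumes "v \<in> V" "R \<in> ind (V - closed_nbhd v)"
  shows "heat_bath lam v f R = (f R + lam * f (insert v R)) / (1 + lam)"
    and "heat_bath lam v f (insert v R) = (f R + lam * f (insert v R)) / (1 + lam)"
proof -
  have "insert v R \<in> ind V"
    using ind_containing[OF assms(1)] assms(2) by blast
  moreover have "R - {v} = R" "insert v R - {v} = R"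
    using assms by (auto simp: ind_iff)
  ultimately show "heat_bath lam v f R = (f R + lam * f (insert v R)) / (1 + lam)"
    "heat_bath lam v f (insert v R) = (f R + lam * f (insert v R)) / (1 + lam)"
    by (simp_all add: heat_bath_def)
qed

lemma heat_bath_blocked:
  assumes "R \<in> ind (V - {v}) - ind (V - closed_nbhd v)"
  shows "heat_bath lam v f R = f R"
proof -
  have "R - {v} = R" "insert v R \<notin> ind V"
    using assms unfolding insert_in_ind_iff by (auto simp: ind_iff)
  then show ?thesis by (simp add: heat_bath_def)
qed

lemma gibbs_sum_heat_bath:
  assumes "v \<in> V"
  shows "gibbs_sum lam V (\<lambda>\<sigma>. g \<sigma> * heat_bath lam v f \<sigma>)
    = (\<Sum>R\<in>ind (V - closed_nbhd v).
        lam ^ card R * ((g R + lam * g (insert v R)) * (f R + lam * f (insert v R)) / (1 + lam)))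
      + (\<Sum>R\<in>ind (V - {v}) - ind (V - closed_nbhd v). lam ^ card R * (g R * f R))"
proof -
  have "x * (F / c) + lam * (y * (F / c)) = (x + lam * y) * F / c" for x y c F :: real
    by (simp add: distrib_right add_divide_distrib)
  then show ?thesis
    unfolding gibbs_sum_pairs[OF assms]
    by (intro arg_cong2[where f = "(+)"] sum.cong refl)
      (simp_all add: heat_bath_free[OF assms] heat_bath_blocked)
qed

lemma gibbs_mean_heat_bath_commute:
  assumes "v \<in> V"
  shows "gibbs_mean lam V (\<lambda>\<sigma>. g \<sigma> * heat_bath lam v f \<sigma>)
    = gibbs_mean lam V (\<lambda>\<sigma>. f \<sigma> * heat_bath lam v g \<sigma>)"
  unfolding gibbs_mean_eq gibbs_sum_heat_bath[OF assms] by (simp add: mult.commute)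

lemma gibbs_mean_heat_bath_idem:
  assumes "0 < lam" "v \<in> V"
  shows "gibbs_mean lam V (\<lambda>\<sigma>. heat_bath lam v f \<sigma> * heat_bath lam v f \<sigma>)
    = gibbs_mean lam V (\<lambda>\<sigma>. f \<sigma> * heat_bath lam v f \<sigma>)"
proof -
  have "heat_bath lam v f R + lam * heat_bath lam v f (insert v R) = f R + lam * f (insert v R)"
    if "R \<in> ind (V - closed_nbhd v)" for R
  proof -
    let ?average = "(f R + lam * f (insert v R)) / (1 + lam)"
    have "?average + lam * ?average = (1 + lam) * ?average"
      by (simp only: distrib_right mult_1)
    then show ?thesis
      using assms(1) by (simp add: heat_bath_free[OF assms(2) that])
  qed
  then show ?thesis
    unfolding gibbs_mean_eq gibbs_sum_heat_bath[OF assms(2)]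
    by (intro arg_cong2[where f = "(/)"] arg_cong2[where f = "(+)"] sum.cong refl)
      (simp_all add: heat_bath_blocked)
qed

lemma gibbs_sum_heat_bath_loss:
  assumes "0 < lam" "v \<in> V"
  shows "gibbs_sum lam V (\<lambda>\<sigma>. f \<sigma> * f \<sigma>) - gibbs_sum lam V (\<lambda>\<sigma>. f \<sigma> * heat_bath lam v f \<sigma>)
    = lam / (1 + lam) * (\<Sum>R\<in>ind (V - closed_nbhd v). lam ^ card R * (f (insert v R) - f R)\<^sup>2)"
proof -
  have "x * x + lam * (y * y) - (x + lam * y) * (x + lam * y) / (1 + lam)
      = lam / (1 + lam) * (y - x)\<^sup>2" for x y :: real
    using assms(1) by (simp add: field_simps power2_eq_square)
  then have "c * (x * x + lam * (y * y)) - c * ((x + lam * y) * (x + lam * y) / (1 + lam))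
      = lam / (1 + lam) * (c * (y - x)\<^sup>2)" for x y c :: real
    unfolding right_diff_distrib[symmetric] by (metis mult.left_commute)
  then show ?thesis
    unfolding gibbs_sum_heat_bath[OF assms(2)] gibbs_sum_pairs[OF assms(2), of _ "\<lambda>\<sigma>. f \<sigma> * f \<sigma>"]
    by (simp only: add_diff_cancel_right sum_subtractf[symmetric] sum_distrib_left)
qed

context
  fixes lam :: real
  assumes lam: "0 < lam" and V_nonempty: "V \<noteq> {}"
begin

lemma card_V_pos: "0 < real (card V)"
  using V_nonempty finite_V by (simp add: card_gt_0_iff)

lemma expectation_glauber_step:
  "measure_pmf.expectation (glauber_step V E lam \<sigma>) f
    = (\<Sum>v\<in>V. heat_bath lam v f \<sigma>) / real (card V)"
proof -
  let ?update = "\<lambda>v. let S = \<sigma> - {v} in if S \<union> {v} \<notin> ind V then return_pmf S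
       else map_pmf (\<lambda>b. if b then S \<union> {v} else S) (bernoulli_pmf (lam / (1 + lam)))"
  have "lam / (1 + lam) \<le> 1" "0 \<le> lam / (1 + lam)" "1 - lam / (1 + lam) = 1 / (1 + lam)"
    using lam by (auto simp: field_simps)
  then have "measure_pmf.expectation (?update v) f = heat_bath lam v f \<sigma>" for v
    by (simp add: Let_def heat_bath_def add_divide_distrib)
  moreover have "measure_pmf.expectation (glauber_step V E lam \<sigma>) f
      = (\<Sum>v\<in>V. measure_pmf.expectation (?update v) f) / real (card V)"
    unfolding glauber_step_def
    by (subst pmf_expectation_bind_pmf_of_set)
      (use V_nonempty finite_V in \<open>auto simp: Let_def sum_divide_distrib field_simps
        intro: sum.cong\<close>)
  ultimately show ?thesis by simp
qed

lemma set_glauber_step_subset: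
  assumes "\<sigma> \<in> ind V"
  shows "set_pmf (glauber_step V E lam \<sigma>) \<subseteq> ind V"
proof -
  have "\<sigma> - {v} \<in> ind V" for v
    using assms by (auto simp: ind_iff)
  then show ?thesis
    unfolding glauber_step_def using V_nonempty finite_V by (auto simp: Let_def split: if_splits)
qed

lemma glauber_detailed_balance:
  assumes "\<sigma> \<in> ind V" "\<tau> \<in> ind V"
  shows "hardcore V E lam \<sigma> * pmf (glauber_step V E lam \<sigma>) \<tau>
    = hardcore V E lam \<tau> * pmf (glauber_step V E lam \<tau>) \<sigma>"
proof -
  have "hardcore V E lam \<sigma> * heat_bath lam v (indicator {\<tau>}) \<sigma>
      = hardcore V E lam \<tau> * heat_bath lam v (indicator {\<sigma>}) \<tau>" if "v \<in> V" for v
    using gibbs_mean_heat_bath_commute[OF that, of lam "indicator {\<sigma>}" "indicator {\<tau>}"] assms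
    by (simp add: weighted_mean_indicator finite_ind finite_V)
  moreover have "pmf (glauber_step V E lam x) y
      = (\<Sum>v\<in>V. heat_bath lam v (indicator {y}) x) / real (card V)" for x y
    unfolding expectation_glauber_step[symmetric] by (simp add: pmf.rep_eq)
  ultimately show ?thesis
    by (simp add: sum_distrib_left)
qed

interpretation glauber: reversible_chain "ind V" "hardcore V E lam" "glauber_step V E lam"
  using finite_distribution_hardcore[OF finite_V] hardcore_pos[OF finite_V] lam
    set_glauber_step_subset glauber_detailed_balance
  by (intro reversible_chain.intro reversible_chain_axioms.intro) auto

lemma transition_op_glauber:
  "glauber.transition_op f \<sigma> = (\<Sum>v\<in>V. heat_bath lam v f \<sigma>) / real (card V)"
  by (simp add: glauber.transition_op_def expectation_glauber_step)

lemma gibbs_mean_transition_op: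
  "gibbs_mean lam V (\<lambda>\<sigma>. g \<sigma> * glauber.transition_op f \<sigma>)
    = (\<Sum>v\<in>V. gibbs_mean lam V (\<lambda>\<sigma>. g \<sigma> * heat_bath lam v f \<sigma>)) / real (card V)"
proof -
  have "(\<lambda>\<sigma>. g \<sigma> * glauber.transition_op f \<sigma>)
      = (\<lambda>\<sigma>. 1 / real (card V) * (\<Sum>v\<in>V. g \<sigma> * heat_bath lam v f \<sigma>))"
    by (simp add: transition_op_glauber sum_distrib_left sum_divide_distrib fun_eq_iff)
  then show ?thesis
    by (simp only: weighted_mean_cmult weighted_mean_sum) simp
qed

text \<open>Each heat bath is an orthogonal projection, and the dynamics averages them.\<close>

lemma glauber_contracting:
  "gibbs_mean lam V (\<lambda>\<sigma>. glauber.transition_op f \<sigma> * glauber.transition_op f \<sigma>)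
    \<le> gibbs_mean lam V (\<lambda>\<sigma>. f \<sigma> * glauber.transition_op f \<sigma>)"
proof -
  have "glauber.transition_op f \<sigma> * glauber.transition_op f \<sigma>
      \<le> 1 / real (card V) * (\<Sum>v\<in>V. heat_bath lam v f \<sigma> * heat_bath lam v f \<sigma>)" for \<sigma>
    using sum_squared_le_sum_of_squares[of "\<lambda>v. heat_bath lam v f \<sigma>" V] card_V_pos
    by (simp add: transition_op_glauber power2_eq_square field_simps)
  then have "gibbs_mean lam V (\<lambda>\<sigma>. glauber.transition_op f \<sigma> * glauber.transition_op f \<sigma>)
      \<le> gibbs_mean lam V
        (\<lambda>\<sigma>. 1 / real (card V) * (\<Sum>v\<in>V. heat_bath lam v f \<sigma> * heat_bath lam v f \<sigma>))"
    by (rule glauber.mean_mono)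
  also have "\<dots> = 1 / real (card V)
      * (\<Sum>v\<in>V. gibbs_mean lam V (\<lambda>\<sigma>. heat_bath lam v f \<sigma> * heat_bath lam v f \<sigma>))"
    by (simp only: weighted_mean_cmult weighted_mean_sum)
  finally show ?thesis
    by (simp add: gibbs_mean_heat_bath_idem[OF lam] gibbs_mean_transition_op)
qed

lemma glauber_dirichlet:
  "Z lam V * (real (card V) * glauber.dirichlet f) = lam / (1 + lam) * flip_energy lam f"
proof -
  have Z_pos_V: "0 < Z lam V"
    using finite_V lam by (intro Z_pos) auto
  have "real (card V) * glauber.dirichlet f
      = (\<Sum>v\<in>V. gibbs_mean lam V (\<lambda>\<sigma>. f \<sigma> * f \<sigma>) - gibbs_mean lam V (\<lambda>\<sigma>. f \<sigma> * heat_bath lam v f \<sigma>))"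
    using card_V_pos
    by (simp add: glauber.dirichlet_def gibbs_mean_transition_op sum_subtractf right_diff_distrib)
  then have "Z lam V * (real (card V) * glauber.dirichlet f)
      = (\<Sum>v\<in>V. gibbs_sum lam V (\<lambda>\<sigma>. f \<sigma> * f \<sigma>) - gibbs_sum lam V (\<lambda>\<sigma>. f \<sigma> * heat_bath lam v f \<sigma>))"
    using Z_pos_V
    by (simp add: gibbs_mean_eq sum_divide_distrib[symmetric] flip: diff_divide_distrib)
  also have "\<dots> = lam / (1 + lam)
      * (\<Sum>v\<in>V. \<Sum>R\<in>ind (V - closed_nbhd v). lam ^ card R * (f (insert v R) - f R)\<^sup>2)"
    by (simp add: gibbs_sum_heat_bath_loss[OF lam] sum_distrib_left)
  also have "\<dots> = lam / (1 + lam) * flip_energy lam f"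
    by (simp only: flip_energy_def sum_distrib_left[of "lam ^ _"] sum_ind_free_swap)
  finally show ?thesis .
qed

lemma glauber_mixing_time_le:
  assumes "1 \<le> \<Gamma>"
    and gap: "\<And>f. scaled_var lam V f \<le> \<Gamma> * (lam / (1 + lam) * flip_energy lam f)"
    and L_ge: "ln 4 + real (card V) * ln ((1 + lam) / min 1 lam) \<le> L"
  shows "ereal_of_enat (glauber_mixing_time V E lam) \<le> ereal (2 * (real (card V) * \<Gamma>) * L)"
proof -
  have Z_pos_V: "0 < Z lam V"
    using finite_V lam by (intro Z_pos) auto
  interpret poincare_chain "ind V" "hardcore V E lam" "glauber_step V E lam" "real (card V) * \<Gamma>"
  proof
    show "1 \<le> real (card V) * \<Gamma>"
      using mult_mono[of 1 "real (card V)" 1 \<Gamma>] assms(1) card_V_pos by simp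
    show "gibbs_cov lam V f f \<le> real (card V) * \<Gamma> * glauber.dirichlet f" for f
    proof -
      have "Z lam V * gibbs_cov lam V f f \<le> Z lam V * (real (card V) * \<Gamma> * glauber.dirichlet f)"
        using gap[of f] scaled_var_eq_cov[OF finite_V less_imp_le[OF lam], of f]
        unfolding glauber_dirichlet[symmetric] by (simp add: mult_ac)
      then show ?thesis using Z_pos_V by simp
    qed
  qed (rule glauber_contracting)
  have "ln (4 / hardcore V E lam x) \<le> L" if "x \<in> ind V" for x
    using ln_inverse_hardcore_le[OF finite_V lam that] hardcore_pos[OF finite_V lam that] L_ge
    by (simp add: ln_div)
  moreover have "1 \<le> L"
  proof -
    have "0 \<le> real (card V) * ln ((1 + lam) / min 1 lam)"
      using lam by (intro mult_nonneg_nonneg ln_ge_zero) (auto simp: min_def)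
    moreover have "1 \<le> ln (4 :: real)"
      using exp_le by (subst ln_ge_iff) auto
    ultimately show ?thesis
      using L_ge by linarith
  qed
  ultimately show ?thesis
    unfolding glauber_mixing_time_def using empty_in_ind
    by (intro mixing_time_le_poincare) auto
qed

end

end

section \<open>Mixing time at the critical fugacity\<close>

lemma ln_lambda_c_ratio_le:
  assumes "2 \<le> d"
  shows "ln ((1 + lambda_c (Suc d)) / min 1 (lambda_c (Suc d))) \<le> 4 * ln (real (Suc d))"
proof -
  let ?lam = "lambda_c (Suc d)"
  have "1 / real (Suc d) \<le> 1 / (real d - 1)"
    using assms by (intro divide_left_mono) auto
  then have lower: "1 / real (Suc d) \<le> min 1 ?lam"
    using lambda_c_ge[OF assms] by simp
  have pos: "0 < ?lam"
    by (rule lambda_c_pos[OF assms])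
  have "1 + ?lam \<le> exp 2 + exp 2"
    using lambda_c_le[OF assms] one_le_exp_iff[of "2 :: real"] by linarith
  also have "\<dots> \<le> exp 1 * exp 2"
    using exp_ge_add_one_self[of "1 :: real"] by simp
  also have "\<dots> = exp (3 :: real)"
    by (simp flip: exp_add)
  finally have "(1 + ?lam) / min 1 ?lam \<le> exp 3 / (1 / real (Suc d))"
    using lower by (intro frac_le) auto
  then have "ln ((1 + ?lam) / min 1 ?lam) \<le> ln (exp 3 * real (Suc d))"
    using pos by (subst ln_le_cancel_iff) auto
  also have "\<dots> = 3 + ln (real (Suc d))"
    by (simp add: ln_mult)
  also have "\<dots> \<le> 4 * ln (real (Suc d))"
    using ln_ge_iff[of "real (Suc d)" 1] exp_le assms by simp
  finally show ?thesis .
qed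

lemma (in finite_simple_graph) glauber_mixing_time_critical_le:
  assumes d_ge_2: "2 \<le> d" and degree: "\<And>v. card (nbhd v) \<le> d + 1" and n_ge_2: "2 \<le> card V"
  shows "ereal_of_enat (glauber_mixing_time V E (lambda_c (Suc d)))
    \<le> ereal (12 * exp 5 * real (card V) powr (4 + 4 / (real d - 1)) * ln (real (Suc d)))"
proof -
  let ?n = "real (card V)" and ?l = "ln (real (Suc d))" and ?lam = "lambda_c (Suc d)"
  have V_ne: "V \<noteq> {}"
    using n_ge_2 by auto
  have "ereal_of_enat (glauber_mixing_time V E ?lam)
      \<le> ereal (2 * (?n * (exp 5 * ?n powr tree_exponent d)) * (6 * ?n * ?l))"
  proof (rule glauber_mixing_time_le[OF lambda_c_pos[OF d_ge_2] V_ne])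
    show "1 \<le> exp 5 * ?n powr tree_exponent d"
      using mult_mono[of 1 "exp 5" 1 "?n powr tree_exponent d"] n_ge_2 d_ge_2
      by (simp add: tree_exponent_def ge_one_powr_ge_zero)
    show "scaled_var ?lam V f
        \<le> exp 5 * ?n powr tree_exponent d * (?lam / (1 + ?lam) * flip_energy ?lam f)" for f
      by (rule poincare_critical[OF d_ge_2 degree n_ge_2])
    have "1 \<le> ?l"
      using ln_ge_iff[of "real (Suc d)" 1] exp_le d_ge_2 by simp
    then have "1 * 1 \<le> ?n * ?l"
      using n_ge_2 by (intro mult_mono) auto
    moreover have "ln 4 \<le> (2 :: real)"
      using ln_2_less_1 ln_realpow[of 2 2] by simp
    moreover have "?n * ln ((1 + ?lam) / min 1 ?lam) \<le> ?n * (4 * ?l)"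
      by (intro mult_left_mono ln_lambda_c_ratio_le d_ge_2) simp
    ultimately show "ln 4 + ?n * ln ((1 + ?lam) / min 1 ?lam) \<le> 6 * ?n * ?l"
      by linarith
  qed
  also have "2 * (?n * (exp 5 * ?n powr tree_exponent d)) * (6 * ?n * ?l)
      = 12 * exp 5 * (?n powr tree_exponent d * ?n\<^sup>2) * ?l"
    by (simp add: power2_eq_square)
  also have "?n powr tree_exponent d * ?n\<^sup>2 = ?n powr (tree_exponent d + 2)"
    using n_ge_2 by (simp add: powr_add)
  also have "tree_exponent d + 2 = 4 + 4 / (real d - 1)"
    using d_ge_2 by (simp add: tree_exponent_def field_simps)
  finally show ?thesis .
qed

theorem theorem1p1:
  "\<exists>C::real. C > 0 \<and>
     (\<forall>(\<Delta>::nat) (n::nat) (V::'a set) (E::'a set set).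
        \<Delta> \<ge> 3 \<longrightarrow> simple_graph V E \<longrightarrow> card V = n \<longrightarrow> max_degree V E = \<Delta> \<longrightarrow>
        ereal_of_enat (glauber_mixing_time V E (lambda_c \<Delta>))
          \<le> ereal (C * real n powr (4 + 4 / (real \<Delta> - 2)) * ln (real \<Delta>)))"
proof (intro exI[of _ "12 * exp 5"] conjI allI impI)
  fix \<Delta> n :: nat and V :: "'a set" and E :: "'a set set"
  assume degree_ge: "\<Delta> \<ge> 3" and graph: "simple_graph V E"
    and card_V: "card V = n" and max_deg: "max_degree V E = \<Delta>"
  interpret finite_simple_graph V E
    by unfold_locales (rule graph)
  obtain d where d_eq: "\<Delta> = Suc d" "2 \<le> d"
    using degree_ge by (cases \<Delta>) auto
  have "V \<noteq> {}"
    using max_deg degree_ge by (auto simp: max_degree_def)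
  then have "2 \<le> card V"
    using max_degree_less_card max_deg degree_ge by simp
  moreover have "card (nbhd v) \<le> d + 1" for v
    using card_nbhd_le_max_degree[of v] max_deg d_eq(1) by simp
  ultimately show "ereal_of_enat (glauber_mixing_time V E (lambda_c \<Delta>))
      \<le> ereal (12 * exp 5 * real n powr (4 + 4 / (real \<Delta> - 2)) * ln (real \<Delta>))"
    using glauber_mixing_time_critical_le[OF d_eq(2)] card_V by (simp add: d_eq(1))
qed simp

end
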